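(* Let $\mathfrak g$ be a non-simply-laced simple Lie algebra, $k\ge1$, $\lambda=\sum_\alpha l_\alpha\omega_\alpha$ a dominant integral weight and $\mathbf n=\{n_{\alpha,j}\}_{\alpha\in I_r,1\le j\le t_\alpha k}$ non-negative integers. Then $$Z^{(k)}_{\lambda;\mathbf n}(\mathbf u)=\prod_{\alpha=1}^r\frac{\mathcal Q_{\alpha,1}(\mathbf u)\,\mathcal Q_{\alpha,t_\alpha k}(\mathbf u)^{l_\alpha+1}}{\mathcal Q_{\alpha,t_\alpha k+1}(\mathbf u)^{l_\alpha+1}}\prod_{i=1}^{t_\alpha k}\frac{\mathcal Q_{\alpha,i}(\mathbf u)^{n_{\alpha,i}}}{u_{\alpha,i}},$$ as an equality of Laurent series in the $u_\alpha$ ($\alpha\in I_r$), where each factor of the product over $\alpha$ is expanded in the corresponding $u_\alpha$.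
   Context: $\mathfrak g$ is $B_r$, $C_r$, $F_4$ or $G_2$; $I_r=\{1,\dots,r\}$; $C_{\alpha,\beta}=2(\alpha_\alpha,\alpha_\beta)/(\alpha_\alpha,\alpha_\alpha)$; $\beta\sim\alpha$ means adjacency in the Dynkin diagram. $t_\alpha=1$ for long simple roots, $t_\alpha=2$ for short simple roots of $B_r,C_r,F_4$, $t_\alpha=3$ for the short simple root of $G_2$. $\gamma$ (long) and $\gamma'$ (short) are the adjacent simple roots of different lengths: $\gamma=r-1,r,2,1$ and $\gamma'=r,r-1,3,2$ for $B_r,C_r,F_4,G_2$ respectively. Formal variables $\mathbf u=\{u_\alpha,u_{\alpha,j},a_j\mid\alpha\in I_r,j\ge1\}$. The functions $\mathcal Q_{\alpha,i}(\mathbf u)$ ($i\ge0$) are defined by $\mathcal Q_{\alpha,0}=1$, $\mathcal Q_{\alpha,1}=u_\alpha^{-1}$ and $$\mathcal Q_{\alpha,i+1}=\frac{\mathcal Q_{\alpha,i}^2-\prod_{\beta\sim\alpha}\mathcal T_i^{(\alpha,\beta)}}{u_{\alpha,i}\,\mathcal Q_{\alpha,i-1}}\quad(i\ge1),$$ where $\mathcal T^{(\alpha,\beta)}_i=\mathcal Q_{\beta,i}$ if $t_\alpha=t_\beta$, $\ \mathcal T_i^{(\gamma,\gamma')}=\mathcal Q_{\gamma',t_{\gamma'}i}$, and $$\mathcal T_i^{(\gamma',\gamma)}=a_i^{\,(-i)\bmod t_{\gamma'}}\prod_{s=0}^{t_{\gamma'}-1}\mathcal Q_{\gamma,\lfloor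 (i+s)/t_{\gamma'}\rfloor},$$ residues mod $t_{\gamma'}$ being taken in $\{0,\dots,t_{\gamma'}-1\}$. Let $J^{(k)}_{\mathfrak g}=\{(\alpha,j):\alpha\in I_r,1\le j\le t_\alpha k\}$. For $\mathbf m=\{m_{\alpha,i}\ge0\}_{(\alpha,i)\in J^{(k)}_{\mathfrak g}}$ set $$q_\alpha=l_\alpha+\sum_{(\beta,j)\in J^{(k)}_{\mathfrak g}}jC_{\alpha,\beta}m_{\beta,j}-\sum_{j=1}^{t_\alpha k}jn_{\alpha,j},$$ $$q_{\alpha,i}=l_\alpha+\sum_{\substack{(\beta,j)\in J^{(k)}_{\mathfrak g}\\ |C_{\alpha,\beta}|j>|C_{\beta,\alpha}|i}}\operatorname{sgn}(C_{\alpha,\beta})(|C_{\alpha,\beta}|j-|C_{\beta,\alpha}|i)m_{\beta,j}-\sum_{j=i+1}^{t_\alpha k}(j-i)n_{\alpha,j},$$ $\Delta_{\alpha,i}=\delta_{\alpha,\gamma'}((-i)\bmod t_{\gamma'})m_{\alpha,i}$, and $$Z^{(k)}_{\lambda;\mathbf n}(\mathbf u)=\sum_{\mathbf m}\prod_{\alpha=1}^r u_\alpha^{q_\alpha}\prod_{i=1}^{t_\alpha k}u_{\alpha,i}^{q_{\alpha,i}}a_i^{\Delta_{\alpha,i}}\binom{m_{\alpha,i}+q_{\alpha,i}}{m_{\alpha,i}},\qquad \binom{m+p}{m}=\frac{(p+m)\cdots(p+1)}{m!}\ (p\in\mathbb Z).$$ Up to an overall monomial, $Z^{(k)}_{\lambda;\mathbf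 n}$ is a power series in the variables $y_\alpha=\prod_\beta u_\beta^{C_{\beta,\alpha}}$ (with coefficients Laurent polynomials in the $u_{\alpha,i}$ and polynomial in the $a_i$). Concretely, each $\mathcal Q_{\alpha,j}^{\pm1}$ with $j\ge1$ is expanded as a monomial times a power series in the $y_\beta$; since $y_\alpha$ is the only one of these containing a positive power of $u_\alpha$, this is the expansion in $u_\alpha$. *)

theory Defs
  imports
    Complex_Main
    "HOL-Library.Poly_Mapping"
    "HOL-Computational_Algebra.Fraction_Field"
begin

subsection \<open>Non-simply-laced types\<close>

datatype nsl_type = B_type nat | C_type nat | F4_type | G2_type

fun nsl_rank :: "nsl_type \<Rightarrow> nat" where
  "nsl_rank (B_type r) = r"
| "nsl_rank (C_type r) = r"
| "nsl_rank F4_type = 4"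
| "nsl_rank G2_type = 2"

text \<open>\<open>C\<^sub>2\<close> is allowed; it is \<open>B\<^sub>2\<close> with the two nodes exchanged.\<close>
fun nsl_valid :: "nsl_type \<Rightarrow> bool" where
  "nsl_valid (B_type r) \<longleftrightarrow> r \<ge> 2"
| "nsl_valid (C_type r) \<longleftrightarrow> r \<ge> 2"
| "nsl_valid F4_type \<longleftrightarrow> True"
| "nsl_valid G2_type \<longleftrightarrow> True"

abbreviation nodes :: "nsl_type \<Rightarrow> nat set" where
  "nodes g \<equiv> {1..nsl_rank g}"

text \<open>The Dynkin diagrams of all four types are paths.\<close>
definition adj :: "nsl_type \<Rightarrow> nat \<Rightarrow> nat \<Rightarrow> bool" where
  "adj g a b \<longleftrightarrow> a \<in> nodes g \<and> b \<in> nodes g \<and> (b = Suc a \<or> a = Suc b)"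

text \<open>The numbers \<open>t\<^sub>\<alpha>\<close>: \<open>1\<close> on long simple roots, the squared length ratio on short ones.\<close>
fun tt :: "nsl_type \<Rightarrow> nat \<Rightarrow> nat" where
  "tt (B_type r) a = (if a = r then 2 else 1)"
| "tt (C_type r) a = (if a = r then 1 else 2)"
| "tt F4_type a = (if a \<le> 2 then 1 else 2)"
| "tt G2_type a = (if a = 1 then 1 else 3)"

text \<open>The short one, \<open>\<gamma>'\<close>, of the two adjacent simple roots of different lengths.\<close>
fun gamma' :: "nsl_type \<Rightarrow> nat" where
  "gamma' (B_type r) = r"
| "gamma' (C_type r) = r - 1"
| "gamma' F4_type = 3"
| "gamma' G2_type = 2"

text \<open>Convention \<open>C\<^sub>\<alpha>\<^sub>\<beta> = 2(\<alpha>,\<beta>)/(\<alpha>,\<alpha>)\<close>: the entry \<open>-t\<close> sits in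
  the row of the short root. See \<open>cartan_eq_form\<close>.\<close>
definition cartan :: "nsl_type \<Rightarrow> nat \<Rightarrow> nat \<Rightarrow> int" where
  "cartan g a b =
     (if a = b then 2
      else if adj g a b then (if tt g b < tt g a then - int (tt g a) else -1)
      else 0)"

text \<open>The invariant form on simple roots, long roots having square length \<open>2\<close>.\<close>
definition root_form :: "nsl_type \<Rightarrow> nat \<Rightarrow> nat \<Rightarrow> rat" where
  "root_form g a b =
     (if a = b then 2 / of_nat (tt g a)
      else if adj g a b then - 1 / of_nat (min (tt g a) (tt g b))
      else 0)"

lemma tt_pos: "tt g a > 0"
  by (cases g) auto

lemma tt_adj:
  assumes "nsl_valid g" "adj g a b" "tt g a \<noteq> tt g b"
  shows "min (tt g a) (tt g b) = 1"
  using assms by (cases g) (auto simp: adj_def split: if_splits)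

lemma cartan_eq_form:
  assumes "nsl_valid g"
  shows "of_int (cartan g a b) = 2 * root_form g a b / root_form g a a"
  using tt_adj[OF assms, of a b] tt_pos[of g a] tt_pos[of g b]
  by (auto simp: cartan_def root_form_def min_def split: if_splits)


subsection \<open>Laurent polynomials and rational functions\<close>

text \<open>\<open>Uv a\<close>, \<open>UUv a j\<close>, \<open>Av j\<close> stand for \<open>u\<^sub>\<alpha>\<close>, \<open>u\<^sub>\<alpha>\<^sub>,\<^sub>j\<close>, \<open>a\<^sub>j\<close>.\<close>
datatype var = Uv nat | UUv nat nat | Av nat

text \<open>The linear order is arbitrary; the library needs one to see that Laurent polynomials
  form an integral domain.\<close>
fun var_code :: "var \<Rightarrow> int \<times> nat \<times> nat" where
  "var_code (Uv a) = (0, a, 0)"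
| "var_code (UUv a j) = (1, a, j)"
| "var_code (Av j) = (2, j, 0)"

lemma var_code_inj: "var_code x = var_code y \<Longrightarrow> x = y"
  by (cases x; cases y) auto

instantiation var :: linorder
begin

definition less_eq_var :: "var \<Rightarrow> var \<Rightarrow> bool" where
  "less_eq_var x y \<longleftrightarrow>
     (case (var_code x, var_code y) of ((p, q, s), (p', q', s')) \<Rightarrow>
        p < p' \<or> p = p' \<and> (q < q' \<or> q = q' \<and> s \<le> s'))"

definition less_var :: "var \<Rightarrow> var \<Rightarrow> bool" where
  "less_var x y \<longleftrightarrow> x \<le> y \<and> \<not> y \<le> x"

instance
proof
  fix x y z :: var
  show "(x < y) = (x \<le> y \<and> \<not> y \<le> x)" by (simp add: less_var_def)
  show "x \<le> x" by (auto simp: less_eq_var_def split: prod.splits)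
  show "x \<le> y \<Longrightarrow> y \<le> z \<Longrightarrow> x \<le> z"
    by (auto simp: less_eq_var_def split: prod.splits)
  show "x \<le> y \<Longrightarrow> y \<le> x \<Longrightarrow> x = y"
    by (rule var_code_inj) (auto simp: less_eq_var_def split: prod.splits)
  show "x \<le> y \<or> y \<le> x"
    by (auto simp: less_eq_var_def split: prod.splits)
qed

end

type_synonym expo = "var \<Rightarrow>\<^sub>0 int"
type_synonym lpoly = "expo \<Rightarrow>\<^sub>0 rat"
type_synonym ratfun = "lpoly fract"

definition rvar :: "var \<Rightarrow> ratfun" where
  "rvar v = Fract (Poly_Mapping.single (Poly_Mapping.single v 1) 1) 1"


subsection \<open>The functions \<open>Q\<close>\<close>

fun tt_short :: "nsl_type \<Rightarrow> nat" where
  "tt_short G2_type = 3"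
| "tt_short _ = 2"

lemma tt_cases: "tt g a = 1 \<or> tt g a = tt_short g"
  by (cases g) auto

lemma tt_short_gt1: "tt_short g > 1"
  by (cases g) auto

text \<open>The factor for \<open>b\<close> in the product is \<open>\<T>\<^sub>i\<^sup>(\<^sup>\<alpha>\<^sup>,\<^sup>\<beta>\<^sup>)\<close>
  with \<open>i = Suc j\<close>. Its three cases are distinguished by comparing \<open>t\<^sub>\<alpha>\<close> and
  \<open>t\<^sub>\<beta>\<close>, because the only adjacent pair with different values is
  \<open>{\<gamma>, \<gamma>'}\<close>.\<close>
function Qfun :: "nsl_type \<Rightarrow> nat \<Rightarrow> nat \<Rightarrow> ratfun" where
  "Qfun g a 0 = 1"
| "Qfun g a (Suc 0) = inverse (rvar (Uv a))"
| "Qfun g a (Suc (Suc j)) =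
    ((Qfun g a (Suc j))\<^sup>2 -
       (\<Prod>b \<in> {b. adj g a b}.
          if tt g a = tt g b then Qfun g b (Suc j)
          else if tt g a < tt g b then Qfun g b (tt g b * Suc j)
          else rvar (Av (Suc j)) ^ nat ((- int (Suc j)) mod int (tt g a)) *
               (\<Prod>s<tt g a. Qfun g b ((Suc j + s) div tt g a))))
    / (rvar (UUv a (Suc j)) * Qfun g a j)"
  by pat_completeness auto

text \<open>The measure orders \<open>Q\<^sub>\<alpha>\<^sub>,\<^sub>i\<close> by \<open>i/t\<^sub>\<alpha>\<close>, corrected so that a
  short \<open>Q\<close> may use the next long one.\<close>
termination
proof (relation "measure (\<lambda>(g, a, i). if tt g a = 1 then 2 * tt_short g * i + 1
                                      else 2 * i + 2 * tt_short g)", goal_cases)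
  case 1
  show ?case by simp
next
  case (2 g a j)
  show ?case using tt_short_gt1[of g] by simp
next
  case (3 g a j b)
  then show ?case using tt_short_gt1[of g] by simp
next
  case (4 g a j b)
  then have "tt g a = 1" "tt g b = tt_short g" "tt g b \<noteq> 1"
    using tt_cases[of g a] tt_cases[of g b] tt_short_gt1[of g] by auto
  then show ?case by simp
next
  case (5 g a j b s)
  then have a: "tt g a = tt_short g" "tt g a \<noteq> 1" and b: "tt g b = 1"
    using tt_cases[of g a] tt_cases[of g b] tt_short_gt1[of g] by auto
  define x where "x = tt_short g * ((Suc j + s) div tt_short g)"
  have "x \<le> Suc j + s"
    by (simp only: x_def times_div_less_eq_dividend)
  moreover have "s < tt_short g"
    using 5 a by simp
  ultimately have "2 * x + 1 < 2 * Suc (Suc j) + 2 * tt_short g"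
    by simp
  then show ?case using a b by (simp add: x_def mult.assoc)
next
  case (6 g a j)
  show ?case using tt_short_gt1[of g] by simp
qed


subsection \<open>Formal series\<close>

text \<open>A series is given by the coefficients of all Laurent monomials. The exponents
  are unrestricted here; \<open>y_series\<close> below carves out the series that
  actually occur, and products of those are given by finite sums.\<close>
type_synonym series = "expo \<Rightarrow> rat"

definition series_one :: series where
  "series_one = (\<lambda>e. if e = 0 then 1 else 0)"

definition series_mult :: "series \<Rightarrow> series \<Rightarrow> series" where
  "series_mult S T = (\<lambda>e. \<Sum>d | S d \<noteq> 0 \<and> T (e - d) \<noteq> 0. S d * T (e - d))"

primrec series_prod :: "(nat \<Rightarrow> series) \<Rightarrow> nat \<Rightarrow> series" where
  "series_prod E 0 = series_one"
| "series_prod E (Suc r) = series_mult (series_prod E r) (E (Suc r))"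

definition lpoly_act :: "lpoly \<Rightarrow> series \<Rightarrow> series" where
  "lpoly_act D S = (\<lambda>e. \<Sum>d\<in>Poly_Mapping.keys D. Poly_Mapping.lookup D d * S (e - d))"

text \<open>The exponent of \<open>\<Prod>\<^sub>\<alpha> y\<^sub>\<alpha>\<^bsup>c \<alpha>\<^esup>\<close>, where
  \<open>y\<^sub>\<alpha> = \<Prod>\<^sub>\<beta> u\<^sub>\<beta>\<^bsup>C \<beta> \<alpha>\<^esup>\<close>.\<close>
definition y_expo :: "nsl_type \<Rightarrow> (nat \<Rightarrow> nat) \<Rightarrow> expo" where
  "y_expo g c = (\<Sum>a\<in>nodes g. \<Sum>b\<in>nodes g. Poly_Mapping.single (Uv b) (cartan g b a * int (c a)))"

text \<open>Monomials in the \<open>u\<^sub>\<alpha>\<^sub>,\<^sub>j\<^sup>\<plusminus>\<^sup>1\<close> and the \<open>a\<^sub>j\<close>.\<close>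
definition coeff_expos :: "expo set" where
  "coeff_expos = {f. (\<forall>a. Poly_Mapping.lookup f (Uv a) = 0) \<and> (\<forall>j. Poly_Mapping.lookup f (Av j) \<ge> 0)}"

text \<open>A monomial times a power series in the \<open>y\<^sub>\<alpha>\<close> whose coefficients are Laurent
  polynomials in the \<open>u\<^sub>\<alpha>\<^sub>,\<^sub>j\<close> and polynomials in the \<open>a\<^sub>j\<close>.\<close>
definition y_series :: "nsl_type \<Rightarrow> series \<Rightarrow> bool" where
  "y_series g S \<longleftrightarrow>
     (\<exists>d. (\<forall>e. S e \<noteq> 0 \<longrightarrow> (\<exists>c. \<exists>f\<in>coeff_expos. e = d + y_expo g c + f)) \<and>
          (\<forall>c. finite {f \<in> coeff_expos. S (d + y_expo g c + f) \<noteq> 0}))"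

text \<open>\<open>S\<close> is the expansion of the rational function \<open>F = P/D\<close>: a series of the above form
  with \<open>D S = P\<close>. It is unique, see \<open>y_expansion_unique\<close>.\<close>
definition y_expansion :: "nsl_type \<Rightarrow> ratfun \<Rightarrow> series \<Rightarrow> bool" where
  "y_expansion g F S \<longleftrightarrow> y_series g S \<and>
     (\<exists>P D. D \<noteq> 0 \<and> F = Fract P D \<and> lpoly_act D S = Poly_Mapping.lookup P)"


subsection \<open>The partition function\<close>

definition Jset :: "nsl_type \<Rightarrow> nat \<Rightarrow> (nat \<times> nat) set" where
  "Jset g k = (SIGMA a : nodes g. {1..tt g a * k})"

definition q_tot :: "nsl_type \<Rightarrow> nat \<Rightarrow> (nat \<Rightarrow> nat) \<Rightarrow> (nat \<Rightarrow> nat \<Rightarrow> nat) \<Rightarrow>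
    (nat \<Rightarrow> nat \<Rightarrow> nat) \<Rightarrow> nat \<Rightarrow> int" where
  "q_tot g k l n m a = int (l a)
     + (\<Sum>(b, j)\<in>Jset g k. int j * cartan g a b * int (m b j))
     - (\<Sum>j = 1..tt g a * k. int j * int (n a j))"

definition q_part :: "nsl_type \<Rightarrow> nat \<Rightarrow> (nat \<Rightarrow> nat) \<Rightarrow> (nat \<Rightarrow> nat \<Rightarrow> nat) \<Rightarrow>
    (nat \<Rightarrow> nat \<Rightarrow> nat) \<Rightarrow> nat \<Rightarrow> nat \<Rightarrow> int" where
  "q_part g k l n m a i = int (l a)
     + (\<Sum>(b, j)\<in>{(b, j). (b, j) \<in> Jset g k \<and> \<bar>cartan g a b\<bar> * int j > \<bar>cartan g b a\<bar> * int i}.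
          sgn (cartan g a b) * (\<bar>cartan g a b\<bar> * int j - \<bar>cartan g b a\<bar> * int i) * int (m b j))
     - (\<Sum>j = i + 1..tt g a * k. int (j - i) * int (n a j))"

definition Delta :: "nsl_type \<Rightarrow> (nat \<Rightarrow> nat \<Rightarrow> nat) \<Rightarrow> nat \<Rightarrow> nat \<Rightarrow> int" where
  "Delta g m a i =
     (if a = gamma' g then ((- int i) mod int (tt g (gamma' g))) * int (m a i) else 0)"

definition Z_expo :: "nsl_type \<Rightarrow> nat \<Rightarrow> (nat \<Rightarrow> nat) \<Rightarrow> (nat \<Rightarrow> nat \<Rightarrow> nat) \<Rightarrow>
    (nat \<Rightarrow> nat \<Rightarrow> nat) \<Rightarrow> expo" where
  "Z_expo g k l n m =
     (\<Sum>a\<in>nodes g. Poly_Mapping.single (Uv a) (q_tot g k l n m a)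
       + (\<Sum>i = 1..tt g a * k. Poly_Mapping.single (UUv a i) (q_part g k l n m a i)
                             + Poly_Mapping.single (Av i) (Delta g m a i)))"

text \<open>\<open>gbin m p\<close> is \<open>(p+m)\<cdots>(p+1)/m!\<close>, also for negative \<open>p\<close>.\<close>
definition gbin :: "nat \<Rightarrow> int \<Rightarrow> rat" where
  "gbin m p = (\<Prod>s = 1..m. of_int (p + int s)) / fact m"

definition Z_weight :: "nsl_type \<Rightarrow> nat \<Rightarrow> (nat \<Rightarrow> nat) \<Rightarrow> (nat \<Rightarrow> nat \<Rightarrow> nat) \<Rightarrow>
    (nat \<Rightarrow> nat \<Rightarrow> nat) \<Rightarrow> rat" where
  "Z_weight g k l n m =
     (\<Prod>a\<in>nodes g. \<Prod>i = 1..tt g a * k. gbin (m a i) (q_part g k l n m a i))"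

text \<open>The families \<open>m = (m\<^sub>\<alpha>\<^sub>,\<^sub>i)\<close> indexed by \<open>Jset g k\<close>, extended by zero.\<close>
definition m_families :: "nsl_type \<Rightarrow> nat \<Rightarrow> (nat \<Rightarrow> nat \<Rightarrow> nat) set" where
  "m_families g k = {m. \<forall>a i. (a, i) \<notin> Jset g k \<longrightarrow> m a i = 0}"

text \<open>The coefficient of a monomial collects the families contributing to it; there are only
  finitely many, see \<open>finite_Z_fibre\<close>.\<close>
definition Z_series :: "nsl_type \<Rightarrow> nat \<Rightarrow> (nat \<Rightarrow> nat) \<Rightarrow> (nat \<Rightarrow> nat \<Rightarrow> nat) \<Rightarrow> series" where
  "Z_series g k l n =
     (\<lambda>e. \<Sum>m\<in>{m \<in> m_families g k. Z_expo g k l n m = e}. Z_weight g k l n m)"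

subsection \<open>Well-definedness\<close>

text \<open>A grading of the monomials in the \<open>u\<^sub>\<alpha>\<close> for which every \<open>y\<^sub>\<alpha>\<close> has
  positive degree.\<close>
fun ht :: "nsl_type \<Rightarrow> nat \<Rightarrow> int" where
  "ht (B_type r) a = (if a = r then int r * int r else 2 * int a * (2 * int r - int a))"
| "ht (C_type r) a = int a * (2 * int r - int a)"
| "ht F4_type a = [0, 22, 42, 30, 16] ! a"
| "ht G2_type a = [0, 10, 6] ! a"

definition y_wt :: "nsl_type \<Rightarrow> nat \<Rightarrow> int" where
  "y_wt g a = (\<Sum>b\<in>nodes g. ht g b * cartan g b a)"

lemma sum_cartan:
  assumes a: "a \<in> nodes g"
  shows "(\<Sum>b\<in>nodes g. f b * cartan g b a) =
    2 * f a + (if a > 1 then f (a - 1) * cartan g (a - 1) a else 0)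
            + (if a < nsl_rank g then f (Suc a) * cartan g (Suc a) a else 0)"
proof -
  let ?N = "{a} \<union> (if a > 1 then {a - 1} else {}) \<union> (if a < nsl_rank g then {Suc a} else {})"
  have "(\<Sum>b\<in>nodes g. f b * cartan g b a) = (\<Sum>b\<in>?N. f b * cartan g b a)"
    using a by (intro sum.mono_neutral_right) (auto simp: cartan_def adj_def)
  also have "\<dots> = 2 * f a + (if a > 1 then f (a - 1) * cartan g (a - 1) a else 0)
            + (if a < nsl_rank g then f (Suc a) * cartan g (Suc a) a else 0)"
    using a by (auto simp: cartan_def)
  finally show ?thesis .
qed

lemma y_wt_pos:
  assumes "nsl_valid g" "a \<in> nodes g"
  shows "y_wt g a > 0"
proof -
  note eq = y_wt_def[of g a, unfolded sum_cartan[OF assms(2)]]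
  show ?thesis
  proof (cases g)
    case (B_type r)
    then have r: "r \<ge> 2" "1 \<le> a" "a \<le> r" using assms by auto
    consider "a = r" | "Suc a = r" | "Suc a < r" using r by linarith
    then show ?thesis
    proof cases
      case 1
      with r B_type show ?thesis unfolding eq
        by (simp add: cartan_def adj_def of_nat_diff algebra_simps)
    next
      case 2
      with r B_type show ?thesis unfolding eq
        by (auto simp: cartan_def adj_def of_nat_diff algebra_simps)
    next
      case 3
      with r B_type show ?thesis unfolding eq
        by (auto simp: cartan_def adj_def of_nat_diff algebra_simps)
    qed
  next
    case (C_type r)
    then have r: "r \<ge> 2" "1 \<le> a" "a \<le> r" using assms by auto
    then show ?thesis unfolding eq using C_type
      by (auto simp: cartan_def adj_def of_nat_diff algebra_simps)
  next
    case F4_type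
    then have "a = 1 \<or> a = 2 \<or> a = 3 \<or> a = 4" using assms by auto
    with F4_type show ?thesis unfolding eq
      by (auto simp: cartan_def adj_def numeral_eq_Suc)
  next
    case G2_type
    then have "a = 1 \<or> a = 2" using assms by auto
    with G2_type show ?thesis unfolding eq
      by (auto simp: cartan_def adj_def numeral_eq_Suc)
  qed
qed

definition u_wt :: "nsl_type \<Rightarrow> expo \<Rightarrow> int" where
  "u_wt g e = (\<Sum>b\<in>nodes g. ht g b * Poly_Mapping.lookup e (Uv b))"

lemma wt_add: "u_wt g (e + f) = u_wt g e + u_wt g f"
  by (simp add: u_wt_def lookup_add algebra_simps sum.distrib)

lemma wt_diff: "u_wt g (e - f) = u_wt g e - u_wt g f"
  by (simp add: u_wt_def lookup_minus algebra_simps sum_subtractf)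

lemma lookup_sum_pm: "Poly_Mapping.lookup (sum f B) x = (\<Sum>a\<in>B. Poly_Mapping.lookup (f a) x)"
  by (induction B rule: infinite_finite_induct) (auto simp: lookup_add)

lemma sum_delta_U:
  assumes "b \<in> nodes g"
  shows "(\<Sum>c\<in>nodes g. Poly_Mapping.lookup (Poly_Mapping.single (Uv c) (f c)) (Uv b)) = (f b :: int)"
  using assms by (simp add: lookup_single when_def)

lemma wt_y_expo: "u_wt g (y_expo g c) = (\<Sum>a\<in>nodes g. y_wt g a * int (c a))"
proof -
  have "Poly_Mapping.lookup (y_expo g c) (Uv b) = (\<Sum>a\<in>nodes g. cartan g b a * int (c a))"
    if "b \<in> nodes g" for b
    unfolding y_expo_def lookup_sum_pm by (intro sum.cong refl sum_delta_U that)
  then have "u_wt g (y_expo g c) =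
      (\<Sum>b\<in>nodes g. ht g b * (\<Sum>a\<in>nodes g. cartan g b a * int (c a)))"
    unfolding u_wt_def by (intro sum.cong refl) simp
  also have "\<dots> = (\<Sum>b\<in>nodes g. \<Sum>a\<in>nodes g. ht g b * cartan g b a * int (c a))"
    by (simp add: sum_distrib_left mult.assoc)
  also have "\<dots> = (\<Sum>a\<in>nodes g. y_wt g a * int (c a))"
    by (subst sum.swap) (simp add: y_wt_def sum_distrib_right)
  finally show ?thesis .
qed

lemma wt_coeff: "f \<in> coeff_expos \<Longrightarrow> u_wt g f = 0"
  by (simp add: u_wt_def coeff_expos_def)

lemma finite_bounded_families:
  assumes "finite (I :: 'a set)" "\<And>a. a \<in> I \<Longrightarrow> w a > (0::int)"
  shows "finite {c :: 'a \<Rightarrow> nat. (\<forall>a. a \<notin> I \<longrightarrow> c a = 0) \<and> (\<Sum>a\<in>I. w a * int (c a)) \<le> N}"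
proof (rule finite_subset)
  show "{c. (\<forall>a. a \<notin> I \<longrightarrow> c a = 0) \<and> (\<Sum>a\<in>I. w a * int (c a)) \<le> N}
      \<subseteq> {c. \<forall>a. (a \<in> I \<longrightarrow> c a \<in> {..nat N}) \<and> (a \<notin> I \<longrightarrow> c a = 0)}"
  proof
    fix c :: "'a \<Rightarrow> nat"
    assume "c \<in> {c. (\<forall>a. a \<notin> I \<longrightarrow> c a = 0) \<and> (\<Sum>a\<in>I. w a * int (c a)) \<le> N}"
    then have c: "\<forall>a. a \<notin> I \<longrightarrow> c a = 0" and N: "(\<Sum>a\<in>I. w a * int (c a)) \<le> N"
      by auto
    have "c a \<le> nat N" if a: "a \<in> I" for a
    proof -
      have "int (c a) \<le> w a * int (c a)"
        using assms(2)[OF a] by (simp add: mult_le_cancel_right1)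
      also have "\<dots> \<le> (\<Sum>a\<in>I. w a * int (c a))"
        using a assms by (intro member_le_sum) (auto simp: less_imp_le)
      finally show ?thesis using N by linarith
    qed
    with c show "c \<in> {c. \<forall>a. (a \<in> I \<longrightarrow> c a \<in> {..nat N}) \<and> (a \<notin> I \<longrightarrow> c a = 0)}"
      by auto
  qed
  show "finite {c. \<forall>a. (a \<in> I \<longrightarrow> c a \<in> {..nat N}) \<and> (a \<notin> I \<longrightarrow> c a = 0)}"
    using assms(1) by (intro finite_set_of_finite_funs) auto
qed

definition loc_fin :: "nsl_type \<Rightarrow> series \<Rightarrow> bool" where
  "loc_fin g S \<longleftrightarrow> (\<forall>N. finite {e. S e \<noteq> 0 \<and> u_wt g e \<le> N})"

lemma loc_fin_y_series:
  assumes "nsl_valid g" "y_series g S"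
  shows "loc_fin g S"
  unfolding loc_fin_def
proof
  fix N
  from assms(2) obtain d where
    d1: "\<And>e. S e \<noteq> 0 \<Longrightarrow> \<exists>c. \<exists>f\<in>coeff_expos. e = d + y_expo g c + f" and
    d2: "\<And>c. finite {f \<in> coeff_expos. S (d + y_expo g c + f) \<noteq> 0}"
    unfolding y_series_def by blast
  define CC where "CC = {c :: nat \<Rightarrow> nat. (\<forall>a. a \<notin> nodes g \<longrightarrow> c a = 0) \<and>
    (\<Sum>a\<in>nodes g. y_wt g a * int (c a)) \<le> N - u_wt g d}"
  have fin: "finite CC"
    unfolding CC_def using y_wt_pos[OF assms(1)] by (intro finite_bounded_families) auto
  have "{e. S e \<noteq> 0 \<and> u_wt g e \<le> N} \<subseteq>
    (\<Union>c\<in>CC. (\<lambda>f. d + y_expo g c + f) ` {f \<in> coeff_expos. S (d + y_expo g c + f) \<noteq> 0})"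
  proof clarify
    fix e assume e: "S e \<noteq> 0" "u_wt g e \<le> N"
    then obtain c f where cf: "f \<in> coeff_expos" "e = d + y_expo g c + f" using d1 by blast
    define c' where "c' = (\<lambda>a. if a \<in> nodes g then c a else 0)"
    have eq: "y_expo g c' = y_expo g c"
      unfolding y_expo_def c'_def by (intro sum.cong refl) simp
    have "u_wt g d + u_wt g (y_expo g c') \<le> N"
      using e cf by (simp add: wt_add wt_coeff eq)
    then have "c' \<in> CC" by (simp add: CC_def c'_def wt_y_expo)
    moreover have "f \<in> {f \<in> coeff_expos. S (d + y_expo g c' + f) \<noteq> 0}" "e = d + y_expo g c' + f"
      using e cf eq by auto
    ultimately show "e \<in> (\<Union>c\<in>CC. (\<lambda>f. d + y_expo g c + f) ` {f \<in> coeff_expos. S (d + y_expo g c + f) \<noteq> 0})"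
      by blast
  qed
  then show "finite {e. S e \<noteq> 0 \<and> u_wt g e \<le> N}"
    using fin d2 by (elim finite_subset) auto
qed

lemma finite_series_mult:
  assumes "nsl_valid g" "y_series g S" "y_series g T"
  shows "finite {d. S d \<noteq> 0 \<and> T (e - d) \<noteq> 0}"
proof (cases "\<exists>x. T x \<noteq> 0")
  case False
  then show ?thesis by simp
next
  case True
  then obtain x where x: "T x \<noteq> 0" by blast
  from assms(3) obtain d where
    d: "\<And>e'. T e' \<noteq> 0 \<Longrightarrow> \<exists>c. \<exists>f\<in>coeff_expos. e' = d + y_expo g c + f"
    unfolding y_series_def by blast
  have ge: "u_wt g d \<le> u_wt g e'" if nz: "T e' \<noteq> 0" for e'
  proof -
    obtain c f where "f \<in> coeff_expos" "e' = d + y_expo g c + f" using d[OF nz] by blast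
    moreover have "(\<Sum>a\<in>nodes g. y_wt g a * int (c a)) \<ge> 0"
      using y_wt_pos[OF assms(1)] by (intro sum_nonneg mult_nonneg_nonneg) (auto simp: less_imp_le)
    ultimately show ?thesis by (simp add: wt_add wt_coeff wt_y_expo)
  qed
  have "{b. S b \<noteq> 0 \<and> T (e - b) \<noteq> 0} \<subseteq> {b. S b \<noteq> 0 \<and> u_wt g b \<le> u_wt g e - u_wt g d}"
  proof clarify
    fix b assume "T (e - b) \<noteq> 0"
    from ge[OF this] show "u_wt g b \<le> u_wt g e - u_wt g d" by (simp add: wt_diff)
  qed
  then show ?thesis
    using loc_fin_y_series[OF assms(1,2)] unfolding loc_fin_def by (meson finite_subset)
qed

lemma finite_Z_fibre:
  assumes "nsl_valid g"
  shows "finite {m \<in> m_families g k. Z_expo g k l n m = e}"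
proof -
  define base where "base = (\<Sum>a\<in>nodes g. ht g a * (int (l a) - (\<Sum>j = 1..tt g a * k. int j * int (n a j))))"
  have J: "finite (Jset g k)" by (simp add: Jset_def)
  have wtZ: "u_wt g (Z_expo g k l n m) = base + (\<Sum>(b, j)\<in>Jset g k. (int j * y_wt g b) * int (m b j))" for m
  proof -
    have "Poly_Mapping.lookup (Z_expo g k l n m) (Uv b) = q_tot g k l n m b" if "b \<in> nodes g" for b
      using that by (simp add: Z_expo_def lookup_sum_pm lookup_add lookup_single when_def)
    then have "u_wt g (Z_expo g k l n m) = (\<Sum>a\<in>nodes g. ht g a * q_tot g k l n m a)"
      by (simp add: u_wt_def)
    also have "\<dots> = base + (\<Sum>a\<in>nodes g. ht g a * (\<Sum>(b, j)\<in>Jset g k. int j * cartan g a b * int (m b j)))"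
      by (simp add: q_tot_def base_def sum.distrib sum_subtractf algebra_simps)
    also have "(\<Sum>a\<in>nodes g. ht g a * (\<Sum>(b, j)\<in>Jset g k. int j * cartan g a b * int (m b j)))
        = (\<Sum>a\<in>nodes g. \<Sum>p\<in>Jset g k. ht g a * cartan g a (fst p) * (int (snd p) * int (m (fst p) (snd p))))"
      by (simp add: sum_distrib_left case_prod_beta algebra_simps)
    also have "\<dots> = (\<Sum>(b, j)\<in>Jset g k. (int j * y_wt g b) * int (m b j))"
      by (subst sum.swap) (simp add: y_wt_def sum_distrib_left sum_distrib_right case_prod_beta algebra_simps)
    finally show ?thesis .
  qed
  define M where "M = {c :: nat \<times> nat \<Rightarrow> nat. (\<forall>p. p \<notin> Jset g k \<longrightarrow> c p = 0) \<and>
    (\<Sum>p\<in>Jset g k. (int (snd p) * y_wt g (fst p)) * int (c p)) \<le> u_wt g e - base}"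
  have "finite M"
    unfolding M_def using y_wt_pos[OF assms] J
    by (intro finite_bounded_families) (auto simp: Jset_def)
  moreover have "{m \<in> m_families g k. Z_expo g k l n m = e} \<subseteq> (\<lambda>c a i. c (a, i)) ` M"
  proof clarify
    fix m assume m: "m \<in> m_families g k" "e = Z_expo g k l n m"
    define c where "c = (\<lambda>p. m (fst p) (snd p))"
    have "c \<in> M"
      using m by (auto simp: c_def M_def m_families_def wtZ case_prod_beta)
    moreover have "m = (\<lambda>a i. c (a, i))" by (simp add: c_def)
    ultimately show "m \<in> (\<lambda>c a i. c (a, i)) ` M" by blast
  qed
  ultimately show ?thesis by (meson finite_imageI finite_subset)
qed

lemma lpoly_act_superset:
  assumes "finite K" "Poly_Mapping.keys D \<subseteq> K"
  shows "lpoly_act D S e = (\<Sum>d\<in>K. Poly_Mapping.lookup D d * S (e - d))"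
  unfolding lpoly_act_def using assms by (intro sum.mono_neutral_left) (auto simp: in_keys_iff)

lemma lpoly_act_single: "lpoly_act (Poly_Mapping.single x c) S e = c * S (e - x)"
  by (subst lpoly_act_superset[of "{x}"]) auto

lemma lpoly_act_add: "lpoly_act (D + D') S e = lpoly_act D S e + lpoly_act D' S e"
proof -
  let ?K = "Poly_Mapping.keys D \<union> Poly_Mapping.keys D'"
  have "lpoly_act D'' S e = (\<Sum>d\<in>?K. Poly_Mapping.lookup D'' d * S (e - d))"
    if "D'' \<in> {D, D', D + D'}" for D''
    using that Poly_Mapping.keys_add[of D D'] by (intro lpoly_act_superset) auto
  then show ?thesis by (simp add: lookup_add algebra_simps sum.distrib)
qed

lemma lpoly_induct:
  fixes D :: lpoly
  assumes single: "\<And>x c. P (Poly_Mapping.single x c)"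
    and add: "\<And>D D'. P D \<Longrightarrow> P D' \<Longrightarrow> P (D + D')"
  shows "P D"
proof -
  have 0: "P 0" using single[of 0 0] by simp
  have "P (\<Sum>x\<in>K. Poly_Mapping.single x (Poly_Mapping.lookup D x))" if "finite K" for K
    using that by (induction K rule: finite_induct) (auto intro: 0 single add)
  moreover have "(\<Sum>x\<in>Poly_Mapping.keys D. Poly_Mapping.single x (Poly_Mapping.lookup D x)) = D"
    by (rule poly_mapping_eqI)
       (simp add: lookup_sum_pm lookup_single when_def in_keys_iff)
  ultimately show ?thesis using finite_keys by metis
qed

lemma lpoly_act_linear:
  "lpoly_act D (\<lambda>e. S e + T e) e = lpoly_act D S e + lpoly_act D T e"
  "lpoly_act D (\<lambda>e. S e - T e) e = lpoly_act D S e - lpoly_act D T e"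
  "lpoly_act D (\<lambda>e. c * S e) e = c * lpoly_act D S e"
  "lpoly_act D (\<lambda>e. S (e - x)) e = lpoly_act D S (e - x)"
  by (simp_all add: lpoly_act_def algebra_simps sum.distrib sum_subtractf sum_distrib_left)

lemma lpoly_act_mult: "lpoly_act (D * D') S = lpoly_act D (lpoly_act D' S)"
proof (rule ext, induction D rule: lpoly_induct)
  case (1 x c)
  show ?case
  proof (induction D' rule: lpoly_induct)
    case (1 y d)
    show ?case by (simp add: mult_single lpoly_act_single algebra_simps)
  next
    case (2 D D')
    then show ?case by (simp add: lpoly_act_single lpoly_act_add algebra_simps)
  qed
next
  case (2 D1 D2)
  then show ?case by (simp add: lpoly_act_add algebra_simps)
qed

lemma lpoly_act_lookup: "lpoly_act D (Poly_Mapping.lookup P) = Poly_Mapping.lookup (D * P)"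
proof (rule ext, induction D rule: lpoly_induct)
  case (1 x c)
  show ?case
  proof (induction P rule: lpoly_induct)
    case (1 y d)
    show ?case by (auto simp: mult_single lpoly_act_single lookup_single when_def algebra_simps)
  next
    case (2 D D')
    then show ?case by (simp add: lpoly_act_single lookup_add algebra_simps)
  qed
next
  case (2 D1 D2)
  then show ?case by (simp add: lpoly_act_add lookup_add algebra_simps)
qed

lemma lpoly_act_eq_0:
  assumes T: "loc_fin g T" and D: "D \<noteq> 0" and eq: "\<And>e. lpoly_act D T e = 0"
  shows "T e = 0"
proof (rule ccontr)
  assume "T e \<noteq> 0"
  define E where "E = {x. T x \<noteq> 0 \<and> u_wt g x \<le> u_wt g e}"
  have E: "finite E" "e \<in> E" using T \<open>T e \<noteq> 0\<close> by (auto simp: E_def loc_fin_def)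
  define w where "w = Min (u_wt g ` E)"
  have "w \<in> u_wt g ` E" unfolding w_def using E by (intro Min_in) auto
  define F where "F = {x \<in> E. u_wt g x = w}"
  have F: "finite F" "F \<noteq> {}" using E \<open>w \<in> u_wt g ` E\<close> by (auto simp: F_def)
  define x where "x = Min F"
  have "x \<in> F" unfolding x_def using F by (rule Min_in)
  have wmin: "w \<le> u_wt g z" if "T z \<noteq> 0" for z
  proof (cases "z \<in> E")
    case True
    then show ?thesis unfolding w_def using E by simp
  next
    case False
    with that have "u_wt g e < u_wt g z" by (simp add: E_def)
    moreover have "w \<le> u_wt g e" unfolding w_def using E by simp
    ultimately show ?thesis by simp
  qed
  have xmin: "x \<le> z" if "T z \<noteq> 0" "u_wt g z = w" for z
  proof -
    have "z \<in> F" using that wmin[OF \<open>T e \<noteq> 0\<close>] by (simp add: F_def E_def)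
    then show ?thesis unfolding x_def using F by simp
  qed
  define K where "K = Poly_Mapping.keys D"
  have K: "finite K" "K \<noteq> {}" using D by (auto simp: K_def)
  define v where "v = Min (u_wt g ` K)"
  have "v \<in> u_wt g ` K" unfolding v_def using K by (intro Min_in) auto
  define G where "G = {y \<in> K. u_wt g y = v}"
  have G: "finite G" "G \<noteq> {}" using K \<open>v \<in> u_wt g ` K\<close> by (auto simp: G_def)
  define y where "y = Min G"
  have "y \<in> G" unfolding y_def using G by (rule Min_in)
  have zero: "T (y + x - d) = 0" if d: "d \<in> K" "d \<noteq> y" for d
  proof (rule ccontr)
    assume nz: "T (y + x - d) \<noteq> 0"
    have wx: "u_wt g x = w" "u_wt g y = v" using \<open>x \<in> F\<close> \<open>y \<in> G\<close> by (auto simp: F_def G_def)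
    have "v \<le> u_wt g d" unfolding v_def using K d by simp
    moreover have "w \<le> v + w - u_wt g d" using wmin[OF nz] wx by (simp add: wt_add wt_diff)
    ultimately have "u_wt g d = v" by simp
    then have "y \<le> d" unfolding y_def using G d by (auto simp: G_def)
    moreover have "x \<le> y + x - d" using xmin[OF nz] wx \<open>u_wt g d = v\<close> by (simp add: wt_add wt_diff)
    then have "x + d \<le> y + x - d + d" by (rule add_right_mono)
    then have "d + x \<le> y + x" by (simp add: add.commute)
    then have "d \<le> y" by simp
    ultimately show False using d by simp
  qed
  have "y \<in> K" "T x \<noteq> 0" using \<open>x \<in> F\<close> \<open>y \<in> G\<close> by (auto simp: F_def E_def G_def)
  have "lpoly_act D T (y + x) = (\<Sum>d\<in>{y}. Poly_Mapping.lookup D d * T (y + x - d))"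
    unfolding lpoly_act_def K_def[symmetric] using zero K \<open>y \<in> K\<close>
    by (intro sum.mono_neutral_right) auto
  also have "\<dots> \<noteq> 0" using \<open>y \<in> K\<close> \<open>T x \<noteq> 0\<close> by (simp add: K_def in_keys_iff)
  finally show False using eq by simp
qed

lemma y_expansion_unique:
  assumes g: "nsl_valid g" and S: "y_expansion g F S" and S': "y_expansion g F S'"
  shows "S = S'"
proof
  fix e
  from S obtain P D where PD: "D \<noteq> 0" "F = Fract P D" "lpoly_act D S = Poly_Mapping.lookup P"
    unfolding y_expansion_def by blast
  from S' obtain P' D' where PD': "D' \<noteq> 0" "F = Fract P' D'" "lpoly_act D' S' = Poly_Mapping.lookup P'"
    unfolding y_expansion_def by blast
  have "P * D' = P' * D" using PD PD' by (simp add: eq_fract)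
  then have "lpoly_act (D' * D) S = lpoly_act (D * D') S'"
    unfolding lpoly_act_mult PD(3) PD'(3) lpoly_act_lookup by (simp add: mult.commute)
  then have eq: "lpoly_act (D * D') (\<lambda>e. S e - S' e) e = 0" for e
    by (simp add: lpoly_act_linear mult.commute[of D' D])
  have "finite {e. S e - S' e \<noteq> 0 \<and> u_wt g e \<le> N}" for N
  proof (rule finite_subset)
    show "{e. S e - S' e \<noteq> 0 \<and> u_wt g e \<le> N}
        \<subseteq> {e. S e \<noteq> 0 \<and> u_wt g e \<le> N} \<union> {e. S' e \<noteq> 0 \<and> u_wt g e \<le> N}"
      by auto
    show "finite ({e. S e \<noteq> 0 \<and> u_wt g e \<le> N} \<union> {e. S' e \<noteq> 0 \<and> u_wt g e \<le> N})"
      using S S' loc_fin_y_series[OF g] by (simp add: y_expansion_def loc_fin_def)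
  qed
  then have "loc_fin g (\<lambda>e. S e - S' e)" by (simp add: loc_fin_def)
  moreover have "D * D' \<noteq> 0" using PD PD' by simp
  ultimately have "S e - S' e = 0" using eq by (rule lpoly_act_eq_0)
  then show "S e = S' e" by simp
qed

end

(* The variables m_(b,j) are summed out one at a time, in the order of increasing j / t_b. A family of
   remaining variables determines, for every node a, the affine function
     L_a(x) = l_a + sum over remaining (b,j) of (C_ab j - C_ba x) m_(b,j) - sum over remaining (a,j) of (j - x) n_(a,j),
   and when the variables (a,j) with j <= s_a have been summed out, the u_a-part of the summand has turned
   into the product over a of Q_(a,s_a)^(L_a(s_a + 1)) Q_(a,s_a + 1)^(- L_a(s_a)). For s = 0 this is the
   monomial in the u_a, since Q_(a,0) = 1 and Q_(a,1) = 1/u_a. Let Y_(a,i) be the quotient of the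
   product of the T's and Q_(a,i)^2, so that Q_(a,i+1) = Q_(a,i)^2 (1 - Y_(a,i)) / (u_(a,i) Q_(a,i-1)). The
   variable m_(a,i) that is next in order enters through Y_(a,i)^m_(a,i) and the binomial coefficient
   only, its q_(a,i) equals L_a(i), and the negative binomial series gives (1 - Y_(a,i))^(- L_a(i) - 1):
   the power L_a(i) is absorbed by the Q-recursion, and one factor 1/(1 - Y_(a,i)) is left over. At the end
   L_a = l_a, and the product of the factors 1/(1 - Y_(a,i)) telescopes. *)

theory Submission
  imports Defs "HOL-Computational_Algebra.Formal_Laurent_Series"
begin

text \<open>The elimination needs infinite sums, negative powers and division at the same time. It
  is therefore carried out in one field: Laurent series in a single auxiliary variable recording the
  degree \<open>u_wt\<close>, with rational functions as coefficients. By \<open>y_wt_pos\<close>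
  every y_a has positive degree, so the sums that occur are finite in each degree, and expanding a
  rational function becomes a field homomorphism \<open>Phi\<close>, under which the Q-recursion is
  plain algebra. The price is the way back: \<open>cone_series\<close> records that the results have
  the exponents and coefficients of a \<open>y_series\<close>.

  The order of summation is what makes a step work. When (a,i) is due, i / t_a lies between s_b /
  t_b and (s_b + 1) / t_b for every b. So each T in Y_(a,i) is, up to a power of a_i, a product of
  powers of Q_(b,s_b) and Q_(b,s_b + 1), with exactly the exponents by which m_(a,i) enters the
  boundary factors. At node a the exponents fit the recursion because L_a is affine: L_a(s_a + 2) =
  2 L_a(s_a + 1) - L_a(s_a). Ties in slope do no harm: by the symmetrised Cartan matrix, the
  coefficient C_ab j - C_ba i vanishes when j / t_b = i / t_a.\<close>

notation fls_nth (infixl \<open>$$\<close> 75)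

subsection \<open>Infinite sums of Laurent series\<close>

text \<open>Finiteness is required for all degrees up to \<open>N\<close> together, not degree by
  degree. This yields a lower bound common to all members, so the sum is again a Laurent series and
  can be multiplied termwise.\<close>

definition fls_summable :: "'i set \<Rightarrow> ('i \<Rightarrow> 'a::zero fls) \<Rightarrow> bool" where
  "fls_summable A F \<longleftrightarrow> (\<forall>N. finite {i\<in>A. \<exists>n\<le>N. F i $$ n \<noteq> 0})"

definition fls_infsum :: "'i set \<Rightarrow> ('i \<Rightarrow> 'a::comm_monoid_add fls) \<Rightarrow> 'a fls" where
  "fls_infsum A F = Abs_fls (\<lambda>n. \<Sum>i | i \<in> A \<and> F i $$ n \<noteq> 0. F i $$ n)"

lemma fls_lower_boundE:
  fixes f :: "'a::zero fls"
  obtains b where "\<And>n. n < b \<Longrightarrow> f $$ n = 0"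
  using fls_eq0_below_subdegree by blast

text \<open>Arbitrary lower bounds in place of the subdegrees let one summation range serve all
  members of a summable family.\<close>

lemma fls_times_nth_bounds:
  fixes f h :: "'a::semiring_0 fls"
  assumes "\<And>n. n < a \<Longrightarrow> f $$ n = 0" "\<And>n. n < b \<Longrightarrow> h $$ n = 0"
  shows "(f * h) $$ n = (\<Sum>i=a..n - b. f $$ i * h $$ (n - i))"
proof -
  have zero: "f $$ i * h $$ (n - i) = 0"
    if "i < a \<or> i < fls_subdegree f \<or> i > n - b \<or> i > n - fls_subdegree h" for i
  proof -
    from that consider "f $$ i = 0" | "h $$ (n - i) = 0"
      using assms(1)[of i] assms(2)[of "n - i"] by fastforce
    then show ?thesis by cases simp_all
  qed
  let ?I = "{fls_subdegree f..n - fls_subdegree h}" and ?J = "{a..n - b}"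
  have "(f * h) $$ n = (\<Sum>i\<in>?I. f $$ i * h $$ (n - i))"
    by (rule fls_times_nth(2))
  also have "\<dots> = (\<Sum>i\<in>?I \<inter> ?J. f $$ i * h $$ (n - i))"
    using zero by (intro sum.mono_neutral_right) auto
  also have "\<dots> = (\<Sum>i\<in>?J. f $$ i * h $$ (n - i))"
    using zero by (intro sum.mono_neutral_left) auto
  finally show ?thesis .
qed

lemma fls_summable_finite_nth:
  assumes "fls_summable A F"
  shows "finite {i \<in> A. F i $$ n \<noteq> 0}"
  using assms by (auto simp: fls_summable_def intro: rev_finite_subset[of "{i\<in>A. \<exists>m\<le>n. F i $$ m \<noteq> 0}"])

lemma fls_summable_lower_bound:
  assumes "fls_summable A F"
  obtains b where "\<And>i n. i \<in> A \<Longrightarrow> n < b \<Longrightarrow> F i $$ n = 0"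
proof -
  define B where "B = {i\<in>A. \<exists>n\<le>0. F i $$ n \<noteq> 0}"
  have B: "finite B" using assms by (simp add: B_def fls_summable_def)
  define b where "b = Min (insert 0 ((\<lambda>i. fls_subdegree (F i)) ` B))"
  have "F i $$ n = 0" if "i \<in> A" "n < b" for i n
  proof (cases "i \<in> B")
    case True
    then have "b \<le> fls_subdegree (F i)" unfolding b_def using B by (intro Min_le) auto
    then show ?thesis using that by simp
  next
    case False
    have "b \<le> 0" unfolding b_def using B by (intro Min_le) auto
    then show ?thesis using False that by (auto simp: B_def)
  qed
  then show ?thesis using that by blast
qed

lemma fls_infsum_nth:
  assumes "fls_summable A F"
  shows "fls_infsum A F $$ n = (\<Sum>i | i \<in> A \<and> F i $$ n \<noteq> 0. F i $$ n)"
proof -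
  obtain b where "\<And>i n. i \<in> A \<Longrightarrow> n < b \<Longrightarrow> F i $$ n = 0"
    using fls_summable_lower_bound[OF assms] by blast
  then have "\<forall>n<b. (\<Sum>i | i \<in> A \<and> F i $$ n \<noteq> 0. F i $$ n) = 0"
    by (auto intro: sum.neutral)
  then show ?thesis
    unfolding fls_infsum_def by (intro nth_Abs_fls_ex_lower_bound) blast
qed

lemma fls_infsum_nth_superset:
  assumes "fls_summable A F" "finite B" "B \<subseteq> A" "\<And>i. i \<in> A \<Longrightarrow> F i $$ n \<noteq> 0 \<Longrightarrow> i \<in> B"
  shows "fls_infsum A F $$ n = (\<Sum>i\<in>B. F i $$ n)"
  unfolding fls_infsum_nth[OF assms(1)] using assms by (intro sum.mono_neutral_left) auto

lemma fls_infsum_singleton: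
  fixes F :: "'i \<Rightarrow> 'a::comm_monoid_add fls"
  shows "fls_infsum {x} F = F x"
proof (rule fls_eqI)
  fix n
  have "fls_summable {x} F" by (simp add: fls_summable_def)
  then show "fls_infsum {x} F $$ n = F x $$ n"
    by (subst fls_infsum_nth_superset[of _ _ "{x}"]) auto
qed

lemma fls_summable_reindex:
  assumes "bij_betw h A B"
  shows "fls_summable A (\<lambda>i. F (h i)) \<longleftrightarrow> fls_summable B F"
proof -
  have "bij_betw h {i\<in>A. \<exists>n\<le>N. F (h i) $$ n \<noteq> 0} {i\<in>B. \<exists>n\<le>N. F i $$ n \<noteq> 0}" for N
    using assms by (auto simp: bij_betw_def inj_on_def)
  then show ?thesis by (auto simp: fls_summable_def dest: bij_betw_finite)
qed

lemma fls_infsum_reindex: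
  assumes "bij_betw h A B"
  shows "fls_infsum A (\<lambda>i. F (h i)) = fls_infsum B F"
proof -
  have "bij_betw h {i\<in>A. F (h i) $$ n \<noteq> 0} {i\<in>B. F i $$ n \<noteq> 0}" for n
    using assms by (auto simp: bij_betw_def inj_on_def)
  then show ?thesis unfolding fls_infsum_def
    by (intro arg_cong[of _ _ Abs_fls] ext sum.reindex_bij_betw)
qed

text \<open>If \<open>c\<close> vanishes below degree \<open>a\<close>, then degree \<open>n\<close>
  of \<open>c * F i\<close> sees \<open>F i\<close> only up to degree \<open>n - a\<close>. Hence
  the finite set of members with a term in these degrees computes both sides.\<close>

lemma
  fixes F :: "'i \<Rightarrow> 'a::semiring_0 fls"
  assumes F: "fls_summable A F"
  shows fls_summable_cmult: "fls_summable A (\<lambda>i. c * F i)"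
    and fls_infsum_cmult: "fls_infsum A (\<lambda>i. c * F i) = c * fls_infsum A F"
proof -
  obtain b where b: "\<And>i n. i \<in> A \<Longrightarrow> n < b \<Longrightarrow> F i $$ n = 0"
    using fls_summable_lower_bound[OF F] by blast
  obtain a where a: "\<And>n. n < a \<Longrightarrow> c $$ n = 0" using fls_lower_boundE[of c] by blast
  have nth: "(c * F i) $$ n = (\<Sum>j=a..n - b. c $$ j * F i $$ (n - j))" if "i \<in> A" for i n
    using a b that by (intro fls_times_nth_bounds) auto
  have sub: "\<exists>m\<le>n - a. F i $$ m \<noteq> 0" if "i \<in> A" "(c * F i) $$ n \<noteq> 0" for i n
  proof (rule ccontr)
    assume "\<not> ?thesis"
    then have "(c * F i) $$ n = 0" unfolding nth[OF that(1)] by (intro sum.neutral) auto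
    with that show False by simp
  qed
  show sm: "fls_summable A (\<lambda>i. c * F i)"
    unfolding fls_summable_def
  proof
    fix N
    have "{i\<in>A. \<exists>n\<le>N. (c * F i) $$ n \<noteq> 0} \<subseteq> {i\<in>A. \<exists>n\<le>N - a. F i $$ n \<noteq> 0}"
    proof
      fix i assume "i \<in> {i\<in>A. \<exists>n\<le>N. (c * F i) $$ n \<noteq> 0}"
      then obtain n where n: "i \<in> A" "n \<le> N" "(c * F i) $$ n \<noteq> 0" by blast
      with sub obtain m where "m \<le> n - a" "F i $$ m \<noteq> 0" by blast
      then have "m \<le> N - a" "F i $$ m \<noteq> 0" using n by auto
      then show "i \<in> {i\<in>A. \<exists>n\<le>N - a. F i $$ n \<noteq> 0}" using n by blast
    qed
    then show "finite {i\<in>A. \<exists>n\<le>N. (c * F i) $$ n \<noteq> 0}"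
      using F finite_subset unfolding fls_summable_def by blast
  qed
  show "fls_infsum A (\<lambda>i. c * F i) = c * fls_infsum A F"
  proof (rule fls_eqI)
    fix n
    define B where "B = {i\<in>A. \<exists>m\<le>n - a. F i $$ m \<noteq> 0}"
    have B: "finite B" "B \<subseteq> A" using F by (auto simp: B_def fls_summable_def)
    have lb: "fls_infsum A F $$ m = 0" if "m < b" for m
      using fls_infsum_nth_superset[OF F finite.emptyI] b that by fastforce
    have "fls_infsum A (\<lambda>i. c * F i) $$ n = (\<Sum>i\<in>B. (c * F i) $$ n)"
      using sub by (intro fls_infsum_nth_superset sm B) (auto simp: B_def)
    also have "\<dots> = (\<Sum>i\<in>B. \<Sum>j=a..n - b. c $$ j * F i $$ (n - j))"
      using B nth by (intro sum.cong refl) auto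
    also have "\<dots> = (\<Sum>j=a..n - b. c $$ j * (\<Sum>i\<in>B. F i $$ (n - j)))"
      by (subst sum.swap) (simp add: sum_distrib_left)
    also have "\<dots> = (\<Sum>j=a..n - b. c $$ j * fls_infsum A F $$ (n - j))"
      using B by (intro sum.cong refl arg_cong2[of _ _ _ _ "(*)"] fls_infsum_nth_superset[symmetric] F)
                 (auto simp: B_def intro: exI[of _ "n - j" for j])
    also have "\<dots> = (c * fls_infsum A F) $$ n"
      using a lb by (intro fls_times_nth_bounds[symmetric]) auto
    finally show "fls_infsum A (\<lambda>i. c * F i) $$ n = (c * fls_infsum A F) $$ n" .
  qed
qed

text \<open>The finite sets of pairs provided by summability over the product project to finite sets
  of rows and columns, which suffice for the iterated sums. That the row sums are summable again is
  what allows the elimination of variables to be repeated.\<close>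

lemma
  fixes F :: "'i \<Rightarrow> 'j \<Rightarrow> 'a::comm_monoid_add fls"
  assumes F: "fls_summable (A \<times> B) (\<lambda>(x, y). F x y)"
  shows fls_summable_Times_inner: "x \<in> A \<Longrightarrow> fls_summable B (F x)"
    and fls_summable_Times_outer: "fls_summable A (\<lambda>x. fls_infsum B (F x))"
    and fls_infsum_Times:
      "fls_infsum (A \<times> B) (\<lambda>(x, y). F x y) = fls_infsum A (\<lambda>x. fls_infsum B (F x))"
proof -
  define P where "P N = {p\<in>A \<times> B. \<exists>n\<le>N. (case p of (x, y) \<Rightarrow> F x y) $$ n \<noteq> 0}" for N
  have P: "finite (P N)" for N using F by (simp add: P_def fls_summable_def)
  show inner: "fls_summable B (F x)" if "x \<in> A" for x
    unfolding fls_summable_def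
  proof
    fix N
    have "{y\<in>B. \<exists>n\<le>N. F x y $$ n \<noteq> 0} \<subseteq> snd ` P N"
      using that by (force simp: P_def)
    then show "finite {y\<in>B. \<exists>n\<le>N. F x y $$ n \<noteq> 0}"
      using P finite_surj by blast
  qed
  have sub: "x \<in> fst ` P N" if "x \<in> A" "n \<le> N" "fls_infsum B (F x) $$ n \<noteq> 0" for x n N
  proof -
    from that(3) have "\<exists>y\<in>B. F x y $$ n \<noteq> 0"
      unfolding fls_infsum_nth[OF inner[OF that(1)]] by (metis (mono_tags, lifting) mem_Collect_eq sum.neutral)
    then obtain y where "y \<in> B" "F x y $$ n \<noteq> 0" by blast
    then have "(x, y) \<in> P N" using that by (auto simp: P_def)
    then show ?thesis by force
  qed
  show outer: "fls_summable A (\<lambda>x. fls_infsum B (F x))"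
    unfolding fls_summable_def
  proof
    fix N
    have "{x\<in>A. \<exists>n\<le>N. fls_infsum B (F x) $$ n \<noteq> 0} \<subseteq> fst ` P N"
      using sub by blast
    then show "finite {x\<in>A. \<exists>n\<le>N. fls_infsum B (F x) $$ n \<noteq> 0}"
      using P finite_surj by blast
  qed
  show "fls_infsum (A \<times> B) (\<lambda>(x, y). F x y) = fls_infsum A (\<lambda>x. fls_infsum B (F x))"
  proof (rule fls_eqI)
    fix n
    define X where "X = fst ` P n"
    define Y where "Y = snd ` P n"
    have XY: "finite X" "X \<subseteq> A" "finite Y" "Y \<subseteq> B" using P by (auto simp: X_def Y_def P_def)
    have mem: "x \<in> X \<and> y \<in> Y" if "x \<in> A" "y \<in> B" "F x y $$ n \<noteq> 0" for x y
    proof -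
      have "(x, y) \<in> P n" using that by (auto simp: P_def)
      then show ?thesis by (force simp: X_def Y_def)
    qed
    have "fls_infsum (A \<times> B) (\<lambda>(x, y). F x y) $$ n = (\<Sum>(x, y)\<in>X \<times> Y. F x y $$ n)"
      using XY mem by (subst fls_infsum_nth_superset[OF F, of "X \<times> Y"]) (auto simp: case_prod_beta)
    also have "\<dots> = (\<Sum>x\<in>X. \<Sum>y\<in>Y. F x y $$ n)"
      by (rule sum.cartesian_product[symmetric])
    also have "\<dots> = (\<Sum>x\<in>X. fls_infsum B (F x) $$ n)"
    proof (rule sum.cong)
      fix x assume "x \<in> X"
      then have x: "x \<in> A" using XY by blast
      show "(\<Sum>y\<in>Y. F x y $$ n) = fls_infsum B (F x) $$ n"
        using XY mem x by (intro fls_infsum_nth_superset[symmetric] inner) auto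
    qed simp
    also have "\<dots> = fls_infsum A (\<lambda>x. fls_infsum B (F x)) $$ n"
      using XY sub[OF _ order_refl] by (intro fls_infsum_nth_superset[symmetric] outer) (auto simp: X_def)
    finally show "fls_infsum (A \<times> B) (\<lambda>(x, y). F x y) $$ n
        = fls_infsum A (\<lambda>x. fls_infsum B (F x)) $$ n" .
  qed
qed

section \<open>The negative binomial series for arbitrary integer exponents\<close>

lemma fls_mult_nth_eq_0:
  fixes f h :: "'a::semiring_0 fls"
  assumes "\<And>n. n < a \<Longrightarrow> f $$ n = 0" "\<And>n. n < b \<Longrightarrow> h $$ n = 0" "n < a + b"
  shows "(f * h) $$ n = 0"
  using assms by (subst fls_times_nth_bounds[of a _ b]) auto

lemma fls_power_nth_eq_0:
  fixes f :: "'a::comm_semiring_1 fls"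
  assumes "\<And>n. n \<le> 0 \<Longrightarrow> f $$ n = 0" "n < int m"
  shows "(f ^ m) $$ n = 0"
  using assms(2)
proof (induction m arbitrary: n)
  case (Suc m)
  show ?case unfolding power_Suc
    using Suc assms(1) by (intro fls_mult_nth_eq_0[of 1 _ "int m"]) auto
qed simp

text \<open>Pascal's rule for the polynomial binomials, valid for negative \<open>q\<close> too: all
  three numerators contain the factor \<open>p\<close>, that is (q+1)...(q+m).\<close>

lemma gbin_Suc_diff: "gbin (Suc m) q - gbin m q = gbin (Suc m) (q - 1)"
proof -
  define p where "p = (\<Prod>s = 1..m. of_int (q + int s) :: rat)"
  have "(\<Prod>s = 1..Suc m. of_int (q + int s) :: rat) = p * of_int (q + int m + 1)"
    by (simp add: p_def algebra_simps)
  moreover have "(\<Prod>s = 1..Suc m. of_int (q - 1 + int s) :: rat) = of_int q * p"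
    unfolding One_nat_def prod.shift_bounds_cl_Suc_ivl
    by (subst prod.atLeast_Suc_atMost) (simp_all add: p_def)
  ultimately have "gbin m q = p / fact m" "gbin (Suc m) q = p * of_int (q + int m + 1) / fact (Suc m)"
    "gbin (Suc m) (q - 1) = of_int q * p / fact (Suc m)"
    unfolding gbin_def by (simp_all only: p_def)
  moreover have "p / fact m = p * of_nat (Suc m) / fact (Suc m)"
    unfolding fact_Suc of_nat_mult by (simp del: of_nat_Suc)
  ultimately show ?thesis
    by (simp only: diff_divide_distrib[symmetric]) (simp add: algebra_simps)
qed

lemma gbin_minus_1: "m > 0 \<Longrightarrow> gbin m (- 1) = 0"
  by (auto simp: gbin_def intro!: bexI[of _ 1])

lemma gbin_0 [simp]: "gbin 0 q = 1"
  by (simp add: gbin_def)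

text \<open>Pascal's rule gives \<open>(1 - Y) * B q = B (q - 1)\<close>. Induction in both
  directions starts at \<open>q = - 1\<close>, where every term but the first vanishes. The map
  \<open>c\<close> brings the rational binomials into the coefficient field; it will be
  \<open>monom_fls g 0\<close>.\<close>

lemma
  fixes Y :: "'a::field fls" and c :: "rat \<Rightarrow> 'a fls"
  assumes c1: "c 1 = 1" and diff: "\<And>x y. c (x - y) = c x - c y"
    and cneg: "\<And>x n. n < 0 \<Longrightarrow> c x $$ n = 0" and Y: "\<And>n. n \<le> 0 \<Longrightarrow> Y $$ n = 0"
  shows fls_summable_gbin: "fls_summable UNIV (\<lambda>m. c (gbin m q) * Y ^ m)"
    and fls_infsum_gbin: "fls_infsum UNIV (\<lambda>m. c (gbin m q) * Y ^ m) = (1 - Y) powi (- q - 1)"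
proof -
  define f where "f q m = c (gbin m q) * Y ^ m" for q m
  define B where "B q = fls_infsum UNIV (f q)" for q
  have c0: "c 0 = 0" using diff[of 0 0] by simp
  have f0: "f q m $$ n = 0" if "n < int m" for q m n
    unfolding f_def using that cneg Y by (intro fls_mult_nth_eq_0[of 0 _ "int m"] fls_power_nth_eq_0) auto
  have sm: "fls_summable UNIV (f q)" for q
    unfolding fls_summable_def
  proof
    fix N
    have "{i\<in>UNIV. \<exists>n\<le>N. f q i $$ n \<noteq> 0} \<subseteq> {..nat N}"
      using f0 by (force simp: not_less)
    then show "finite {i\<in>UNIV. \<exists>n\<le>N. f q i $$ n \<noteq> 0}" by (rule finite_subset) simp
  qed
  from this[of q] show "fls_summable UNIV (\<lambda>m. c (gbin m q) * Y ^ m)" unfolding f_def[abs_def] .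
  have Y0: "Y $$ 0 = 0" and "Y \<noteq> 1" using Y[of 0] by auto
  \<comment> \<open>Truncation at \<open>N\<close> leaves the boundary term
    \<open>f q N * Y\<close>, which has no coefficient in degrees up to \<open>N\<close> and so is
    invisible in the degree compared in \<open>step\<close>.\<close>
  have part: "(\<Sum>m\<le>N. (1 - Y) * f q m) = (\<Sum>m\<le>N. f (q - 1) m) - f q N * Y" for q N
  proof (induction N)
    case 0
    then show ?case by (simp add: f_def c1)
  next
    case (Suc N)
    have "(\<Sum>m\<le>Suc N. (1 - Y) * f q m) - (\<Sum>m\<le>N. f (q - 1) m)
        = f q (Suc N) - f q N * Y - f q (Suc N) * Y"
      using Suc by (simp add: algebra_simps)
    also have "f q (Suc N) - f q N * Y = (c (gbin (Suc N) q) - c (gbin N q)) * Y ^ Suc N"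
      by (simp add: f_def algebra_simps)
    also have "\<dots> = f (q - 1) (Suc N)"
      by (simp add: f_def diff[symmetric] gbin_Suc_diff)
    finally show ?case by (simp add: algebra_simps)
  qed
  have step: "(1 - Y) * B q = B (q - 1)" for q
  proof (rule fls_eqI)
    fix n
    define N where "N = nat n"
    have N: "n < int N + 1" by (simp add: N_def)
    have z: "((1 - Y) * f q m) $$ n = 0" if "m > N" for m
      using f0 that N Y
      by (intro fls_mult_nth_eq_0[of 0 _ "int m"]) auto
    have "((1 - Y) * B q) $$ n = fls_infsum UNIV (\<lambda>m. (1 - Y) * f q m) $$ n"
      by (simp only: B_def fls_infsum_cmult[OF sm])
    also have "\<dots> = (\<Sum>m\<le>N. ((1 - Y) * f q m) $$ n)"
      using z by (intro fls_infsum_nth_superset fls_summable_cmult[OF sm]) (auto simp: not_less[symmetric])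
    also have "\<dots> = (\<Sum>m\<le>N. f (q - 1) m $$ n) - (f q N * Y) $$ n"
      unfolding fls_nth_sum[symmetric] part by simp
    also have "(f q N * Y) $$ n = 0"
      using f0 N Y by (intro fls_mult_nth_eq_0[of "int N" _ 1]) auto
    also have "(\<Sum>m\<le>N. f (q - 1) m $$ n) - 0 = B (q - 1) $$ n"
      unfolding B_def diff_0_right using f0 N
      by (intro fls_infsum_nth_superset[symmetric] sm) (auto simp: not_less[symmetric])
    finally show "((1 - Y) * B q) $$ n = B (q - 1) $$ n" .
  qed
  have nz: "1 - Y \<noteq> 0" using \<open>Y \<noteq> 1\<close> by simp
  then have pw: "(1 - Y) powi (- j) = (1 - Y) * (1 - Y) powi (- j - 1)" for j
    using power_int_add_1'[of "1 - Y" "- j - 1"] by simp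
  have base: "B (- 1) = 1"
  proof (rule fls_eqI)
    fix n
    have "f (- 1) m = 0" if "m > 0" for m using gbin_minus_1[OF that] by (simp add: f_def c0)
    then have "B (- 1) $$ n = (\<Sum>m\<in>{0}. f (- 1) m $$ n)" unfolding B_def
      by (intro fls_infsum_nth_superset sm) fastforce+
    then show "B (- 1) $$ n = 1 $$ n" by (simp add: f_def c1)
  qed
  have "B q = (1 - Y) powi (- q - 1)"
  proof (induction q rule: int_induct[where k = "- 1"])
    case base
    then show ?case using \<open>B (- 1) = 1\<close> by simp
  next
    case (step1 i)
    have "(1 - Y) * B (i + 1) = (1 - Y) * (1 - Y) powi (- (i + 1) - 1)"
      using step[of "i + 1"] step1 pw[of "i + 1"] by simp
    then show ?case using nz by simp
  next
    case (step2 i)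
    have "B (i - 1) = (1 - Y) * (1 - Y) powi (- i - 1)" using step[of i] step2 by simp
    also have "\<dots> = (1 - Y) powi (- (i - 1) - 1)" using pw[of i] by simp
    finally show ?case .
  qed
  then show "fls_infsum UNIV (\<lambda>m. c (gbin m q) * Y ^ m) = (1 - Y) powi (- q - 1)"
    by (simp add: B_def f_def[abs_def])
qed

subsection \<open>Rational functions as Laurent series in the degree\<close>

definition emb :: "lpoly \<Rightarrow> ratfun" where
  "emb p = Fract p 1"

lemma emb_0 [simp]: "emb 0 = 0"
  and emb_1 [simp]: "emb 1 = 1"
  and emb_add: "emb (p + q) = emb p + emb q"
  and emb_diff: "emb (p - q) = emb p - emb q"
  and emb_mult: "emb (p * q) = emb p * emb q"
  and emb_eq_iff [simp]: "emb p = emb q \<longleftrightarrow> p = q"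
  by (simp_all add: emb_def eq_fract Zero_fract_def One_fract_def)

lemma emb_eq_0_iff [simp]: "emb p = 0 \<longleftrightarrow> p = 0"
  using emb_eq_iff[of p 0] by simp

lemma emb_sum: "emb (sum f A) = (\<Sum>x\<in>A. emb (f x))"
  by (induction A rule: infinite_finite_induct) (auto simp: emb_add)

text \<open>Series are handled as Laurent series in an auxiliary variable that records the degree \<open>u_wt\<close>:
  the coefficient of degree \<open>N\<close> is the Laurent polynomial of all terms of degree \<open>N\<close>, embedded in the
  field of rational functions in order to make the Laurent series a field.\<close>
definition ser :: "nsl_type \<Rightarrow> ratfun fls \<Rightarrow> series" where
  "ser g F = (\<lambda>e. Poly_Mapping.lookup (inv emb (F $$ u_wt g e)) e)"

lemma inv_emb [simp]: "inv emb (emb p) = p"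
  by (rule inv_f_f) (simp add: inj_def)

lemma ser_eq:
  assumes "F $$ u_wt g e = emb p"
  shows "ser g F e = Poly_Mapping.lookup p e"
  using assms by (simp add: ser_def)

definition monom_fls :: "nsl_type \<Rightarrow> expo \<Rightarrow> rat \<Rightarrow> ratfun fls" where
  "monom_fls g e c = fls_shift (- u_wt g e) (fls_const (emb (Poly_Mapping.single e c)))"

lemma monom_fls_nth: "monom_fls g e c $$ N = emb (if N = u_wt g e then Poly_Mapping.single e c else 0)"
  by (simp add: monom_fls_def fls_const_nth)

lemma monom_fls_times_nth: "(monom_fls g e c * F) $$ N = emb (Poly_Mapping.single e c) * F $$ (N - u_wt g e)"
proof -
  have "monom_fls g e c * F = fls_shift (- u_wt g e) (fls_const (emb (Poly_Mapping.single e c)) * F)"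
    by (simp add: monom_fls_def fls_shifted_times_simps)
  then show ?thesis by simp
qed

lemma u_wt_0 [simp]: "u_wt g 0 = 0"
  by (simp add: u_wt_def)

lemma monom_fls_0_1 [simp]: "monom_fls g 0 1 = 1"
  by (rule fls_eqI) (simp add: monom_fls_nth)

lemma monom_fls_0_right [simp]: "monom_fls g e 0 = 0"
  by (rule fls_eqI) (simp add: monom_fls_nth)

lemma monom_fls_nonzero [simp]: "c \<noteq> 0 \<Longrightarrow> monom_fls g e c \<noteq> 0"
  using monom_fls_nth[of g e c "u_wt g e"]
  by (metis emb_eq_0_iff fls_zero_nth lookup_single_eq lookup_zero)

lemma monom_fls_mult: "monom_fls g e c * monom_fls g e' c' = monom_fls g (e + e') (c * c')"
  by (rule fls_eqI)
     (auto simp: monom_fls_times_nth monom_fls_nth emb_mult[symmetric] mult_single wt_add)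

lemma monom_fls_diff: "monom_fls g e (c - c') = monom_fls g e c - monom_fls g e c'"
  by (rule fls_eqI) (simp add: monom_fls_nth single_diff emb_diff)

text \<open>The substitution that multiplies each monomial by the auxiliary variable to the power of
  its degree. The monomial itself stays in the coefficient, so nothing is lost and
  \<open>phi\<close> is an injective ring homomorphism.\<close>

definition phi :: "nsl_type \<Rightarrow> lpoly \<Rightarrow> ratfun fls" where
  "phi g P = (\<Sum>e\<in>Poly_Mapping.keys P. monom_fls g e (Poly_Mapping.lookup P e))"

definition wt_part :: "nsl_type \<Rightarrow> int \<Rightarrow> lpoly \<Rightarrow> lpoly" where
  "wt_part g N P = (\<Sum>e\<in>Poly_Mapping.keys P.
     if N = u_wt g e then Poly_Mapping.single e (Poly_Mapping.lookup P e) else 0)"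

lemma phi_nth: "phi g P $$ N = emb (wt_part g N P)"
  by (simp add: phi_def fls_nth_sum monom_fls_nth emb_sum wt_part_def)

lemma lookup_wt_part:
  "Poly_Mapping.lookup (wt_part g N P) e = (if N = u_wt g e then Poly_Mapping.lookup P e else 0)"
proof -
  have "Poly_Mapping.lookup (wt_part g N P) e =
      (\<Sum>x\<in>Poly_Mapping.keys P. if x = e then (if N = u_wt g e then Poly_Mapping.lookup P e else 0) else 0)"
    unfolding wt_part_def lookup_sum_pm by (intro sum.cong refl) (auto simp: lookup_single when_def)
  then show ?thesis by (simp add: in_keys_iff)
qed

lemma phi_add: "phi g (P + Q) = phi g P + phi g Q"
proof (rule fls_eqI)
  fix N
  have "wt_part g N (P + Q) = wt_part g N P + wt_part g N Q"
    by (rule poly_mapping_eqI) (simp add: lookup_wt_part lookup_add)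
  then show "phi g (P + Q) $$ N = (phi g P + phi g Q) $$ N" by (simp add: phi_nth emb_add)
qed

lemma phi_single [simp]: "phi g (Poly_Mapping.single e c) = monom_fls g e c"
  by (simp add: phi_def)

lemma phi_1 [simp]: "phi g 1 = 1"
  using phi_single[of g 0 1] by (simp del: phi_single)

lemma phi_mult: "phi g (P * Q) = phi g P * phi g Q"
proof (induction P rule: lpoly_induct)
  case (1 x c)
  show ?case
    by (induction Q rule: lpoly_induct) (simp_all add: mult_single monom_fls_mult phi_add distrib_left)
qed (simp_all add: phi_add distrib_right)

lemma phi_eq_0_iff [simp]: "phi g P = 0 \<longleftrightarrow> P = 0"
proof
  assume "phi g P = 0"
  then have "wt_part g N P = 0" for N using phi_nth[of g P N] by simp
  then have "Poly_Mapping.lookup P e = 0" for e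
    using lookup_wt_part[of g "u_wt g e" P e] by simp
  then show "P = 0" by (intro poly_mapping_eqI) simp
qed (simp add: phi_def)

lemma phi_diff: "phi g (P - Q) = phi g P - phi g Q"
  using phi_add[of g "P - Q" Q] by simp

lemma ser_phi: "ser g (phi g P) = Poly_Mapping.lookup P"
  by (rule ext) (simp add: ser_def phi_nth lookup_wt_part)

text \<open>\<open>ser\<close> is meaningful only where the coefficients are Laurent polynomials,
  since \<open>inv emb\<close> is arbitrary elsewhere. The induction therefore also carries along
  that the coefficients of the product lie in the range of \<open>emb\<close>.\<close>

lemma ser_phi_times:
  assumes "\<And>N. F $$ N \<in> range emb"
  shows "ser g (phi g P * F) = lpoly_act P (ser g F)"
proof -
  have "(phi g P * F) $$ N \<in> range emb \<and>
    (\<forall>e. ser g (phi g P * F) e = lpoly_act P (ser g F) e)" for N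
  proof (induction P arbitrary: N rule: lpoly_induct)
    case (1 x c)
    have "(monom_fls g x c * F) $$ N = emb (Poly_Mapping.single x c * inv emb (F $$ (N - u_wt g x)))" for N
      using assms[of "N - u_wt g x"] by (auto simp: monom_fls_times_nth emb_mult)
    moreover have "Poly_Mapping.lookup (Poly_Mapping.single x c * p) e = c * Poly_Mapping.lookup p (e - x)"
      for p :: lpoly and e
      by (simp add: lpoly_act_lookup[symmetric] lpoly_act_single)
    ultimately show ?case by (simp add: ser_def lpoly_act_single wt_diff)
  next
    case (2 P Q)
    have "ser g (phi g (P + Q) * F) e = ser g (phi g P * F) e + ser g (phi g Q * F) e" for e
    proof -
      obtain p q where "(phi g P * F) $$ u_wt g e = emb p" "(phi g Q * F) $$ u_wt g e = emb q"
        using 2 by blast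
      then show ?thesis
        by (simp add: ser_def phi_add distrib_right emb_add[symmetric] lookup_add)
    qed
    moreover obtain p q where "(phi g P * F) $$ N = emb p" "(phi g Q * F) $$ N = emb q"
      using 2 by blast
    then have "(phi g (P + Q) * F) $$ N = emb (p + q)"
      by (simp add: phi_add distrib_right emb_add)
    ultimately show ?case using 2 by (simp add: lpoly_act_add)
  qed
  then show ?thesis by blast
qed

text \<open>Extension of \<open>phi\<close> to fractions; since \<open>phi\<close> is an injective
  ring homomorphism, the representative chosen does not matter (\<open>Phi_Fract\<close>). The
  target being a field, the expansion of an inverse is forced.\<close>

definition Phi :: "nsl_type \<Rightarrow> ratfun \<Rightarrow> ratfun fls" where
  "Phi g F = (case SOME (P, D). D \<noteq> 0 \<and> F = Fract P D of (P, D) \<Rightarrow> phi g P / phi g D)"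

lemma Phi_Fract:
  assumes "D \<noteq> 0"
  shows "Phi g (Fract P D) = phi g P / phi g D"
proof -
  define pd where "pd = (SOME (P', D'). D' \<noteq> 0 \<and> Fract P D = Fract P' D')"
  have "case pd of (P', D') \<Rightarrow> D' \<noteq> 0 \<and> Fract P D = Fract P' D'"
    unfolding pd_def by (rule someI[of _ "(P, D)"]) (use assms in simp)
  then obtain P' D' where pd: "pd = (P', D')" "D' \<noteq> 0" "Fract P D = Fract P' D'"
    by (cases pd) auto
  then have "P * D' = P' * D" using assms by (simp add: eq_fract)
  then have "phi g P * phi g D' = phi g P' * phi g D" by (simp add: phi_mult[symmetric])
  moreover have "Phi g (Fract P D) = phi g P' / phi g D'"
    unfolding Phi_def pd_def[symmetric] pd(1) by simp
  ultimately show ?thesis using pd assms by (simp add: frac_eq_eq)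
qed

lemma Phi_0 [simp]: "Phi g 0 = 0"
  and Phi_1 [simp]: "Phi g 1 = 1"
  by (simp_all add: Zero_fract_def One_fract_def Phi_Fract)

lemma Phi_diff: "Phi g (F - G) = Phi g F - Phi g G"
proof (cases F rule: Fract_cases, cases G rule: Fract_cases)
  fix a b c d :: lpoly assume "F = Fract a b" "b \<noteq> 0" "G = Fract c d" "d \<noteq> 0"
  then show ?thesis by (simp add: Phi_Fract phi_mult phi_diff diff_frac_eq)
qed

lemma Phi_mult: "Phi g (F * G) = Phi g F * Phi g G"
proof (cases F rule: Fract_cases, cases G rule: Fract_cases)
  fix a b c d :: lpoly assume "F = Fract a b" "b \<noteq> 0" "G = Fract c d" "d \<noteq> 0"
  then show ?thesis by (simp add: Phi_Fract phi_mult)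
qed

lemma Phi_inverse: "Phi g (inverse F) = inverse (Phi g F)"
proof (cases "F = 0")
  case False
  then have "Phi g F * Phi g (inverse F) = 1" by (simp add: Phi_mult[symmetric])
  then show ?thesis by (simp add: inverse_unique)
qed simp

lemma Phi_divide: "Phi g (F / G) = Phi g F / Phi g G"
  by (simp add: divide_inverse Phi_mult Phi_inverse)

lemma Phi_power: "Phi g (F ^ n) = Phi g F ^ n"
  by (induction n) (simp_all add: Phi_mult)

lemma Phi_prod: "Phi g (prod f A) = (\<Prod>x\<in>A. Phi g (f x))"
  by (induction A rule: infinite_finite_induct) (simp_all add: Phi_mult)

lemma Phi_rvar: "Phi g (rvar v) = monom_fls g (Poly_Mapping.single v 1) 1"
  by (simp add: rvar_def Phi_Fract)

subsection \<open>Laurent series with coefficients in a cone\<close>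

definition cone :: "nsl_type \<Rightarrow> expo \<Rightarrow> expo set" where
  "cone g d = {e. \<exists>c. \<exists>f\<in>coeff_expos. e = d + y_expo g c + f}"

text \<open>Requiring \<open>u_wt g e = N\<close> ties the auxiliary degree to the exponents:
  \<open>ser\<close> looks up the monomial \<open>e\<close> only in degree \<open>u_wt g e\<close>
  and would drop it anywhere else.\<close>

definition cone_series :: "nsl_type \<Rightarrow> expo \<Rightarrow> ratfun fls set" where
  "cone_series g d = {F. \<forall>N. \<exists>p. F $$ N = emb p \<and>
     (\<forall>e\<in>Poly_Mapping.keys p. u_wt g e = N \<and> e \<in> cone g d)}"

lemma coeff_expos_0 [simp]: "0 \<in> coeff_expos"
  and coeff_expos_add: "f \<in> coeff_expos \<Longrightarrow> f' \<in> coeff_expos \<Longrightarrow> f + f' \<in> coeff_expos"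
  by (auto simp: coeff_expos_def lookup_add)

lemma y_expo_0 [simp]: "y_expo g (\<lambda>_. 0) = 0"
  by (simp add: y_expo_def)

lemma y_expo_add: "y_expo g (\<lambda>a. c a + c' a) = y_expo g c + y_expo g c'"
  by (simp add: y_expo_def sum.distrib[symmetric] distrib_left single_add)

lemma cone_self [simp]: "d \<in> cone g d"
  unfolding cone_def using coeff_expos_0 by (force intro: exI[of _ "\<lambda>_. 0"])

lemma cone_add: "e \<in> cone g d \<Longrightarrow> e' \<in> cone g d' \<Longrightarrow> e + e' \<in> cone g (d + d')"
proof -
  assume "e \<in> cone g d" "e' \<in> cone g d'"
  then obtain c f c' f' where "f \<in> coeff_expos" "e = d + y_expo g c + f"
    "f' \<in> coeff_expos" "e' = d' + y_expo g c' + f'" by (auto simp: cone_def)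
  then have "e + e' = d + d' + y_expo g (\<lambda>a. c a + c' a) + (f + f')" "f + f' \<in> coeff_expos"
    by (simp_all add: y_expo_add coeff_expos_add ac_simps)
  then show ?thesis by (auto simp: cone_def)
qed

lemma cone_seriesE:
  assumes "F \<in> cone_series g d"
  obtains p where "\<And>N. F $$ N = emb (p N)" "\<And>N e. e \<in> Poly_Mapping.keys (p N) \<Longrightarrow> u_wt g e = N"
    "\<And>N e. e \<in> Poly_Mapping.keys (p N) \<Longrightarrow> e \<in> cone g d"
proof -
  from assms have "\<forall>N. \<exists>p. F $$ N = emb p \<and> (\<forall>e\<in>Poly_Mapping.keys p. u_wt g e = N \<and> e \<in> cone g d)"
    by (simp add: cone_series_def)
  then have "\<exists>p. \<forall>N. F $$ N = emb (p N) \<and> (\<forall>e\<in>Poly_Mapping.keys (p N). u_wt g e = N \<and> e \<in> cone g d)"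
    by (rule choice)
  then show ?thesis using that by blast
qed

lemma cone_seriesI:
  assumes "\<And>N. F $$ N = emb (p N)" "\<And>N e. e \<in> Poly_Mapping.keys (p N) \<Longrightarrow> u_wt g e = N \<and> e \<in> cone g d"
  shows "F \<in> cone_series g d"
  using assms unfolding cone_series_def by blast

lemma monom_fls_cone_series: "e \<in> cone g d \<Longrightarrow> monom_fls g e c \<in> cone_series g d"
  by (rule cone_seriesI[of _ "\<lambda>N. if N = u_wt g e then Poly_Mapping.single e c else 0"])
     (auto simp: monom_fls_nth split: if_splits)

lemma one_cone_series [simp]: "1 \<in> cone_series g 0"
  using monom_fls_cone_series[of 0 g 0 1] by simp

lemma cone_series_diff:
  assumes "F \<in> cone_series g d" "G \<in> cone_series g d"
  shows "F - G \<in> cone_series g d"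
proof -
  obtain p where p: "\<And>N. F $$ N = emb (p N)"
    "\<And>N e. e \<in> Poly_Mapping.keys (p N) \<Longrightarrow> u_wt g e = N" "\<And>N e. e \<in> Poly_Mapping.keys (p N) \<Longrightarrow> e \<in> cone g d"
    using cone_seriesE[OF assms(1)] by blast
  obtain q where q: "\<And>N. G $$ N = emb (q N)"
    "\<And>N e. e \<in> Poly_Mapping.keys (q N) \<Longrightarrow> u_wt g e = N" "\<And>N e. e \<in> Poly_Mapping.keys (q N) \<Longrightarrow> e \<in> cone g d"
    using cone_seriesE[OF assms(2)] by blast
  have "u_wt g e = N \<and> e \<in> cone g d" if "e \<in> Poly_Mapping.keys (p N - q N)" for e N
  proof -
    have "e \<in> Poly_Mapping.keys (p N) \<or> e \<in> Poly_Mapping.keys (q N)"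
      using that by (auto simp: in_keys_iff lookup_minus)
    then show ?thesis using p q by blast
  qed
  then show ?thesis using p(1) q(1) by (intro cone_seriesI[of _ "\<lambda>N. p N - q N"]) (auto simp: emb_diff)
qed

lemma cone_series_infsum:
  assumes "fls_summable A F" "\<And>i. i \<in> A \<Longrightarrow> F i \<in> cone_series g d"
  shows "fls_infsum A F \<in> cone_series g d"
proof -
  have "\<exists>p. F i $$ N = emb p \<and> (\<forall>e\<in>Poly_Mapping.keys p. u_wt g e = N \<and> e \<in> cone g d)" if "i \<in> A" for i N
    using assms(2)[OF that] by (simp add: cone_series_def)
  then obtain p where p: "\<And>i N. i \<in> A \<Longrightarrow> F i $$ N = emb (p i N)"
    "\<And>i N e. i \<in> A \<Longrightarrow> e \<in> Poly_Mapping.keys (p i N) \<Longrightarrow> u_wt g e = N \<and> e \<in> cone g d"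
    by metis
  have keys: "e \<in> Poly_Mapping.keys (\<Sum>i\<in>B. p i N) \<Longrightarrow> \<exists>i\<in>B. e \<in> Poly_Mapping.keys (p i N)" for B N e
    unfolding in_keys_iff lookup_sum_pm by (meson sum.not_neutral_contains_not_neutral)
  show ?thesis
  proof (rule cone_seriesI[of _ "\<lambda>N. \<Sum>i | i \<in> A \<and> F i $$ N \<noteq> 0. p i N"])
    fix N
    show "fls_infsum A F $$ N = emb (\<Sum>i | i \<in> A \<and> F i $$ N \<noteq> 0. p i N)"
      unfolding fls_infsum_nth[OF assms(1)] emb_sum using p by (intro sum.cong) auto
  next
    fix N e
    assume "e \<in> Poly_Mapping.keys (\<Sum>i | i \<in> A \<and> F i $$ N \<noteq> 0. p i N)"
    then show "u_wt g e = N \<and> e \<in> cone g d" using keys p by fastforce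
  qed
qed

text \<open>Lower bounds for the degrees reduce both products to finite sums. By homogeneity the key
  sets of different degrees are disjoint, so the double sum over degrees and keys is a single sum
  over \<open>K\<close>.\<close>

lemma
  assumes F: "F \<in> cone_series g d" and G: "G \<in> cone_series g d'"
  shows cone_series_mult: "F * G \<in> cone_series g (d + d')"
    and ser_mult: "ser g (F * G) = series_mult (ser g F) (ser g G)"
proof -
  obtain p where p: "\<And>N. F $$ N = emb (p N)"
    "\<And>N e. e \<in> Poly_Mapping.keys (p N) \<Longrightarrow> u_wt g e = N" "\<And>N e. e \<in> Poly_Mapping.keys (p N) \<Longrightarrow> e \<in> cone g d"
    using cone_seriesE[OF F] by blast
  obtain q where q: "\<And>N. G $$ N = emb (q N)"
    "\<And>N e. e \<in> Poly_Mapping.keys (q N) \<Longrightarrow> u_wt g e = N" "\<And>N e. e \<in> Poly_Mapping.keys (q N) \<Longrightarrow> e \<in> cone g d'"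
    using cone_seriesE[OF G] by blast
  obtain a where a: "\<And>n. n < a \<Longrightarrow> F $$ n = 0" using fls_lower_boundE[of F] by blast
  obtain b where b: "\<And>n. n < b \<Longrightarrow> G $$ n = 0" using fls_lower_boundE[of G] by blast
  define r where "r N = (\<Sum>i=a..N - b. p i * q (N - i))" for N
  have r: "(F * G) $$ N = emb (r N)" for N
    using a b unfolding r_def by (subst fls_times_nth_bounds[of a _ b]) (auto simp: p q emb_sum emb_mult)
  have keys_r: "u_wt g e = N \<and> e \<in> cone g (d + d')" if e: "e \<in> Poly_Mapping.keys (r N)" for e N
  proof -
    obtain i where "e \<in> Poly_Mapping.keys (p i * q (N - i))"
      using e unfolding in_keys_iff r_def lookup_sum_pm by (meson sum.not_neutral_contains_not_neutral)
    then obtain x y where "e = x + y" "x \<in> Poly_Mapping.keys (p i)" "y \<in> Poly_Mapping.keys (q (N - i))"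
      using keys_mult by blast
    then show ?thesis using p(2,3) q(2,3) by (fastforce simp: wt_add intro: cone_add)
  qed
  show "F * G \<in> cone_series g (d + d')" using r keys_r by (rule cone_seriesI)
  show "ser g (F * G) = series_mult (ser g F) (ser g G)"
  proof
    fix e
    define N where "N = u_wt g e"
    define K where "K = (\<Union>i\<in>{a..N - b}. Poly_Mapping.keys (p i))"
    have K: "finite K" by (simp add: K_def)
    have coeff: "ser g F x * ser g G (e - x) =
        Poly_Mapping.lookup (p (u_wt g x)) x * Poly_Mapping.lookup (q (N - u_wt g x)) (e - x)" for x
      by (simp add: ser_def p(1) q(1) wt_diff N_def)
    have "ser g (F * G) e = (\<Sum>i=a..N - b. \<Sum>x\<in>Poly_Mapping.keys (p i).
        Poly_Mapping.lookup (p i) x * Poly_Mapping.lookup (q (N - i)) (e - x))"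
      using ser_eq[OF r[of "u_wt g e"]]
      by (simp add: r_def lookup_sum_pm lpoly_act_lookup[symmetric] lpoly_act_def N_def)
    also have "\<dots> = (\<Sum>i=a..N - b. \<Sum>x\<in>Poly_Mapping.keys (p i). ser g F x * ser g G (e - x))"
      unfolding coeff
    proof (intro sum.cong refl)
      fix i x assume "x \<in> Poly_Mapping.keys (p i)"
      then have "u_wt g x = i" by (rule p(2))
      then show "Poly_Mapping.lookup (p i) x * Poly_Mapping.lookup (q (N - i)) (e - x) =
        Poly_Mapping.lookup (p (u_wt g x)) x * Poly_Mapping.lookup (q (N - u_wt g x)) (e - x)" by simp
    qed
    also have "\<dots> = (\<Sum>x\<in>K. ser g F x * ser g G (e - x))"
      unfolding K_def by (intro sum.UNION_disjoint[symmetric]) (auto dest!: p(2))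
    also have "\<dots> = (\<Sum>x | ser g F x \<noteq> 0 \<and> ser g G (e - x) \<noteq> 0. ser g F x * ser g G (e - x))"
    proof (rule sum.mono_neutral_right[OF K])
      show "{x. ser g F x \<noteq> 0 \<and> ser g G (e - x) \<noteq> 0} \<subseteq> K"
      proof
        fix x assume x: "x \<in> {x. ser g F x \<noteq> 0 \<and> ser g G (e - x) \<noteq> 0}"
        then have "x \<in> Poly_Mapping.keys (p (u_wt g x))" "q (N - u_wt g x) \<noteq> 0"
          by (auto simp: ser_def p(1) q(1) wt_diff N_def in_keys_iff)
        moreover from this have "\<not> u_wt g x < a" "\<not> N - u_wt g x < b"
          using a[of "u_wt g x"] b[of "N - u_wt g x"] p(1) q(1) by auto
        ultimately show "x \<in> K" by (auto simp: K_def)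
      qed
    qed auto
    finally show "ser g (F * G) e = series_mult (ser g F) (ser g G) e"
      by (simp add: series_mult_def)
  qed
qed

lemma ser_1: "ser g 1 = series_one"
  using ser_phi[of g 1] by (simp add: series_one_def lookup_one when_def fun_eq_iff)

text \<open>Elements of \<open>coeff_expos\<close> have degree 0, so for fixed \<open>c\<close> all
  exponents \<open>d + y_expo g c + f\<close> lie in one degree and are among the finitely many keys
  of one Laurent polynomial.\<close>

lemma y_series_ser:
  assumes "F \<in> cone_series g d"
  shows "y_series g (ser g F)"
proof -
  obtain p where p: "\<And>N. F $$ N = emb (p N)"
    "\<And>N e. e \<in> Poly_Mapping.keys (p N) \<Longrightarrow> e \<in> cone g d"
    using cone_seriesE[OF assms] by metis
  have ser: "ser g F e = Poly_Mapping.lookup (p (u_wt g e)) e" for e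
    using p by (simp add: ser_def)
  have "finite {f \<in> coeff_expos. ser g F (d + y_expo g c + f) \<noteq> 0}" for c
  proof (rule finite_imageD)
    show "inj_on (\<lambda>f. d + y_expo g c + f) {f \<in> coeff_expos. ser g F (d + y_expo g c + f) \<noteq> 0}"
      by (simp add: inj_on_def)
    have "(\<lambda>f. d + y_expo g c + f) ` {f \<in> coeff_expos. ser g F (d + y_expo g c + f) \<noteq> 0}
        \<subseteq> Poly_Mapping.keys (p (u_wt g (d + y_expo g c)))"
      by (auto simp: ser in_keys_iff wt_add wt_coeff)
    then show "finite ((\<lambda>f. d + y_expo g c + f) ` {f \<in> coeff_expos. ser g F (d + y_expo g c + f) \<noteq> 0})"
      by (rule finite_subset) simp
  qed
  moreover have "e \<in> cone g d" if "ser g F e \<noteq> 0" for e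
    using that p(2) by (simp add: ser in_keys_iff)
  ultimately show ?thesis unfolding y_series_def cone_def by blast
qed

lemma y_expansion_ser_Phi:
  assumes "Phi g F \<in> cone_series g d"
  shows "y_expansion g F (ser g (Phi g F))"
proof -
  obtain P D where F: "F = Fract P D" "D \<noteq> 0" by (rule Fract_cases)
  have "Phi g F $$ N \<in> range emb" for N
    using assms unfolding cone_series_def by blast
  then have "lpoly_act D (ser g (Phi g F)) = ser g (phi g D * Phi g F)"
    by (simp add: ser_phi_times)
  also have "phi g D * Phi g F = phi g P" using F by (simp add: Phi_Fract)
  finally have "lpoly_act D (ser g (Phi g F)) = Poly_Mapping.lookup P" by (simp add: ser_phi)
  then show ?thesis unfolding y_expansion_def using F y_series_ser[OF assms] by blast
qed

subsection \<open>Leading monomials\<close>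

definition unit_series :: "nsl_type \<Rightarrow> ratfun fls set" where
  "unit_series g = {G. G \<in> cone_series g 0 \<and> inverse G \<in> cone_series g 0 \<and> G \<noteq> 0}"

text \<open>The exponents of the u_(a,j) are left free, as they affect neither degree nor cone.
  Those of the a_j must vanish: inverses are taken freely, and \<open>coeff_expos\<close> admits no
  negative power of an a_j.\<close>

definition lead_series :: "nsl_type \<Rightarrow> (nat \<Rightarrow> int) \<Rightarrow> ratfun fls set" where
  "lead_series g v = {F. \<exists>d. \<exists>G\<in>unit_series g. F = monom_fls g d 1 * G \<and>
     (\<forall>b. Poly_Mapping.lookup d (Uv b) = v b) \<and> (\<forall>j. Poly_Mapping.lookup d (Av j) = 0)}"

lemma one_unit_series [simp]: "1 \<in> unit_series g"
  by (simp add: unit_series_def)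

lemma unit_series_mult: "F \<in> unit_series g \<Longrightarrow> G \<in> unit_series g \<Longrightarrow> F * G \<in> unit_series g"
  using cone_series_mult[of _ g 0 _ 0] by (auto simp: unit_series_def)

lemma unit_series_inverse: "F \<in> unit_series g \<Longrightarrow> inverse F \<in> unit_series g"
  by (auto simp: unit_series_def)

lemma monom_fls_inverse: "inverse (monom_fls g d 1) = monom_fls g (- d) 1"
  by (rule inverse_unique) (simp add: monom_fls_mult)

lemma lead_series_mult:
  assumes "F \<in> lead_series g v" "G \<in> lead_series g w" "\<And>b. u b = v b + w b"
  shows "F * G \<in> lead_series g u"
proof -
  from assms(1) obtain d F' where F: "F' \<in> unit_series g" "F = monom_fls g d 1 * F'"
    "\<forall>b. Poly_Mapping.lookup d (Uv b) = v b" "\<forall>j. Poly_Mapping.lookup d (Av j) = 0"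
    by (auto simp: lead_series_def)
  from assms(2) obtain d' G' where G: "G' \<in> unit_series g" "G = monom_fls g d' 1 * G'"
    "\<forall>b. Poly_Mapping.lookup d' (Uv b) = w b" "\<forall>j. Poly_Mapping.lookup d' (Av j) = 0"
    by (auto simp: lead_series_def)
  have "F * G = (monom_fls g d 1 * monom_fls g d' 1) * (F' * G')" by (simp add: F(2) G(2) ac_simps)
  then have "F * G = monom_fls g (d + d') 1 * (F' * G')" by (simp add: monom_fls_mult)
  then show ?thesis unfolding lead_series_def using F G assms(3)
    by (intro CollectI exI[of _ "d + d'"] bexI[of _ "F' * G'"] unit_series_mult)
       (auto simp: lookup_add)
qed

lemma lead_series_inverse:
  assumes "F \<in> lead_series g v" "\<And>b. u b = - v b"
  shows "inverse F \<in> lead_series g u"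
proof -
  from assms(1) obtain d F' where F: "F' \<in> unit_series g" "F = monom_fls g d 1 * F'"
    "\<forall>b. Poly_Mapping.lookup d (Uv b) = v b" "\<forall>j. Poly_Mapping.lookup d (Av j) = 0"
    by (auto simp: lead_series_def)
  then show ?thesis unfolding lead_series_def using assms(2)
    by (intro CollectI exI[of _ "- d"] bexI[of _ "inverse F'"] unit_series_inverse)
       (auto simp: monom_fls_inverse)
qed

lemma lead_series_divide:
  assumes "F \<in> lead_series g v" "G \<in> lead_series g w" "\<And>b. u b = v b - w b"
  shows "F / G \<in> lead_series g u"
  unfolding divide_inverse
  by (rule lead_series_mult[OF assms(1) lead_series_inverse[OF assms(2) refl]]) (simp add: assms(3))

lemma lead_series_unit: "F \<in> unit_series g \<Longrightarrow> F \<in> lead_series g (\<lambda>_. 0)"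
  unfolding lead_series_def by (intro CollectI exI[of _ 0] bexI[of _ F]) auto

lemma lead_series_power:
  assumes "F \<in> lead_series g v" "\<And>b. u b = int n * v b"
  shows "F ^ n \<in> lead_series g u"
proof -
  have "F ^ n \<in> lead_series g (\<lambda>b. int n * v b)"
  proof (induction n)
    case (Suc n)
    then show ?case unfolding power_Suc
      by (rule lead_series_mult[OF assms(1)]) (simp add: algebra_simps)
  qed (use lead_series_unit[OF one_unit_series] in simp)
  moreover have "(\<lambda>b. int n * v b) = u" using assms(2) by auto
  ultimately show ?thesis by simp
qed

lemma lead_series_prod:
  assumes "\<And>x. x \<in> A \<Longrightarrow> f x \<in> lead_series g (v x)" "\<And>b. u b = (\<Sum>x\<in>A. v x b)"
  shows "prod f A \<in> lead_series g u"
proof -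
  have "prod f A \<in> lead_series g (\<lambda>b. \<Sum>x\<in>A. v x b)" using assms(1)
  proof (induction A rule: infinite_finite_induct)
    case (insert x A)
    then show ?case by (auto intro!: lead_series_mult[of _ g "v x" _ "\<lambda>b. \<Sum>x\<in>A. v x b"])
  qed (use lead_series_unit[OF one_unit_series] in simp_all)
  moreover have "(\<lambda>b. \<Sum>x\<in>A. v x b) = u" using assms(2) by auto
  ultimately show ?thesis by simp
qed

lemma lead_series_nonzero: "F \<in> lead_series g v \<Longrightarrow> F \<noteq> 0"
  by (auto simp: lead_series_def unit_series_def)

lemma lead_series_cone_series:
  assumes "F \<in> lead_series g v"
  shows "\<exists>d. F \<in> cone_series g d"
proof -
  from assms obtain d G where "G \<in> cone_series g 0" "F = monom_fls g d 1 * G"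
    by (auto simp: lead_series_def unit_series_def)
  then show ?thesis using cone_series_mult[OF monom_fls_cone_series[OF cone_self]] by blast
qed

lemma monom_fls_UU_lead_series: "monom_fls g (Poly_Mapping.single (UUv a i) 1) 1 \<in> lead_series g (\<lambda>_. 0)"
  unfolding lead_series_def
  by (intro CollectI exI[of _ "Poly_Mapping.single (UUv a i) 1"] bexI[of _ 1]) (auto simp: lookup_single)

lemma cone_0_u_wt_nonneg:
  assumes "nsl_valid g" "e \<in> cone g 0"
  shows "u_wt g e \<ge> 0"
proof -
  obtain c f where "f \<in> coeff_expos" "e = y_expo g c + f" using assms(2) by (auto simp: cone_def)
  moreover have "(\<Sum>a\<in>nodes g. y_wt g a * int (c a)) \<ge> 0"
    using y_wt_pos[OF assms(1)] by (intro sum_nonneg mult_nonneg_nonneg) (auto simp: less_imp_le)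
  ultimately show ?thesis by (simp add: wt_add wt_coeff wt_y_expo)
qed

lemma cone_series_0_nth_neg:
  assumes "nsl_valid g" "F \<in> cone_series g 0" "n < 0"
  shows "F $$ n = 0"
proof -
  obtain p where p: "F $$ n = emb p" "\<forall>e\<in>Poly_Mapping.keys p. u_wt g e = n \<and> e \<in> cone g 0"
    using assms(2) unfolding cone_series_def by blast
  then have "Poly_Mapping.keys p = {}"
    using cone_0_u_wt_nonneg[OF assms(1)] assms(3) by fastforce
  then show ?thesis using p by simp
qed

text \<open>A series of positive degree in the cone at 0 may be substituted into the binomial
  series. Membership in the cone survives infinite summation, hence the inverse of
  \<open>1 - Y\<close> stays there.\<close>

lemma
  assumes Y: "Y \<in> cone_series g 0" "\<And>n. n \<le> 0 \<Longrightarrow> Y $$ n = 0"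
  shows summable_gbin: "fls_summable UNIV (\<lambda>m. monom_fls g 0 (gbin m q) * Y ^ m)"
    and infsum_gbin: "fls_infsum UNIV (\<lambda>m. monom_fls g 0 (gbin m q) * Y ^ m) = (1 - Y) powi (- q - 1)"
    and unit_series_1_minus: "1 - Y \<in> unit_series g"
proof -
  have neg: "monom_fls g 0 x $$ n = 0" if "n < 0" for x n
    using that by (simp add: monom_fls_nth)
  show sm: "fls_summable UNIV (\<lambda>m. monom_fls g 0 (gbin m q) * Y ^ m)" for q
    using Y(2) neg by (intro fls_summable_gbin) (auto simp: monom_fls_diff)
  show inf: "fls_infsum UNIV (\<lambda>m. monom_fls g 0 (gbin m q) * Y ^ m) = (1 - Y) powi (- q - 1)" for q
    using Y(2) neg by (intro fls_infsum_gbin) (auto simp: monom_fls_diff)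
  \<comment> \<open>All \<open>gbin m 0\<close> are 1: the case \<open>q = 0\<close> is the
    geometric series for the inverse of \<open>1 - Y\<close>.\<close>
  have "monom_fls g 0 (gbin m 0) * Y ^ m \<in> cone_series g 0" for m
  proof -
    have "Y ^ m \<in> cone_series g 0"
      by (induction m) (use Y(1) cone_series_mult[of _ g 0 _ 0] in auto)
    then show ?thesis
      using cone_series_mult[OF monom_fls_cone_series[OF cone_self, of g 0], of "Y ^ m" 0] by simp
  qed
  with sm have "fls_infsum UNIV (\<lambda>m. monom_fls g 0 (gbin m 0) * Y ^ m) \<in> cone_series g 0"
    by (intro cone_series_infsum)
  then have "inverse (1 - Y) \<in> cone_series g 0" by (simp add: inf)
  moreover have "1 - Y \<noteq> 0" using Y(2)[of 0] by auto
  ultimately show "1 - Y \<in> unit_series g"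
    using Y(1) by (simp add: unit_series_def cone_series_diff)
qed

subsection \<open>The series of the functions \<open>Q\<close>\<close>

definition Qser :: "nsl_type \<Rightarrow> nat \<Rightarrow> nat \<Rightarrow> ratfun fls" where
  "Qser g a i = Phi g (Qfun g a i)"

abbreviation UUser :: "nsl_type \<Rightarrow> nat \<Rightarrow> nat \<Rightarrow> ratfun fls" where
  "UUser g a i \<equiv> monom_fls g (Poly_Mapping.single (UUv a i) 1) 1"

abbreviation Aser :: "nsl_type \<Rightarrow> nat \<Rightarrow> ratfun fls" where
  "Aser g i \<equiv> monom_fls g (Poly_Mapping.single (Av i) 1) 1"

text \<open>The power of a_i is split off into \<open>Aexp\<close>. What remains is a product of
  functions Q alone, which \<open>Tser_eq_powi\<close> can match with the boundary factors.\<close>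

definition Tser :: "nsl_type \<Rightarrow> nat \<Rightarrow> nat \<Rightarrow> nat \<Rightarrow> ratfun fls" where
  "Tser g a b i =
     (if tt g a = tt g b then Qser g b i
      else if tt g a < tt g b then Qser g b (tt g b * i)
      else (\<Prod>s<tt g a. Qser g b ((i + s) div tt g a)))"

definition Aexp :: "nsl_type \<Rightarrow> nat \<Rightarrow> nat \<Rightarrow> nat" where
  "Aexp g a i = (if a = gamma' g then nat ((- int i) mod int (tt g a)) else 0)"

definition Yser :: "nsl_type \<Rightarrow> nat \<Rightarrow> nat \<Rightarrow> ratfun fls" where
  "Yser g a i = Aser g i ^ Aexp g a i * (\<Prod>b | adj g a b. Tser g a b i) / Qser g a i ^ 2"

text \<open>Only one edge of the diagram joins roots of different lengths, so the product over the
  neighbours contains the power of a_i exactly once at \<open>gamma' g\<close> and never at other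
  nodes.\<close>

lemma ex_long_neighbour:
  assumes "nsl_valid g"
  obtains c where "\<And>a. {b. adj g a b \<and> tt g b < tt g a} = (if a = gamma' g then {c} else {})"
proof -
  have "\<exists>c. \<forall>a. {b. adj g a b \<and> tt g b < tt g a} = (if a = gamma' g then {c} else {})"
  proof (cases g)
    case (B_type r)
    then show ?thesis using assms by (intro exI[of _ "r - 1"]) (auto simp: adj_def split: if_splits)
  next
    case (C_type r)
    then show ?thesis using assms by (intro exI[of _ r]) (auto simp: adj_def split: if_splits)
  next
    case F4_type
    then show ?thesis by (intro exI[of _ 2]) (auto simp: adj_def split: if_splits)
  next
    case G2_type
    then show ?thesis by (intro exI[of _ 1]) (auto simp: adj_def split: if_splits)
  qed
  then show ?thesis using that by blast
qed

lemma adj_nodes: "adj g a b \<Longrightarrow> a \<in> nodes g \<and> b \<in> nodes g"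
  by (simp add: adj_def)

lemma finite_adj [simp]: "finite {b. adj g a b}"
  by (rule finite_subset[of _ "nodes g"]) (auto simp: adj_def)

lemma Qser_0 [simp]: "Qser g a 0 = 1"
  by (simp add: Qser_def)

lemma Qser_1: "Qser g a (Suc 0) = monom_fls g (- Poly_Mapping.single (Uv a) 1) 1"
  by (simp add: Qser_def Phi_inverse Phi_rvar monom_fls_inverse)

lemma Qser_Suc_Suc:
  assumes g: "nsl_valid g" and Q: "Qser g a (Suc j) \<noteq> 0"
  shows "Qser g a (Suc (Suc j)) =
    Qser g a (Suc j) ^ 2 * (1 - Yser g a (Suc j)) / (UUser g a (Suc j) * Qser g a j)"
proof -
  let ?i = "Suc j"
  obtain c where c: "\<And>a. {b. adj g a b \<and> tt g b < tt g a} = (if a = gamma' g then {c} else {})"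
    using ex_long_neighbour[OF g] by blast
  let ?A = "\<lambda>b. if tt g b < tt g a then Aser g ?i ^ nat ((- int ?i) mod int (tt g a)) else 1"
  have "Phi g (\<Prod>b | adj g a b.
          if tt g a = tt g b then Qfun g b (Suc j)
          else if tt g a < tt g b then Qfun g b (tt g b * Suc j)
          else rvar (Av (Suc j)) ^ nat ((- int (Suc j)) mod int (tt g a)) *
               (\<Prod>s<tt g a. Qfun g b ((Suc j + s) div tt g a)))
      = (\<Prod>b | adj g a b. ?A b * Tser g a b ?i)"
    unfolding Phi_prod
    by (intro prod.cong refl) (simp add: Tser_def Qser_def Phi_mult Phi_power Phi_rvar Phi_prod)
  also have "\<dots> = (\<Prod>b | adj g a b. ?A b) * (\<Prod>b | adj g a b. Tser g a b ?i)"
    by (rule prod.distrib)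
  also have "(\<Prod>b | adj g a b. ?A b) =
      (\<Prod>b\<in>{b. adj g a b \<and> tt g b < tt g a}. Aser g ?i ^ nat ((- int ?i) mod int (tt g a)))"
    by (simp add: prod.inter_restrict[symmetric] Int_def prod.If_cases)
  also have "\<dots> = Aser g ?i ^ Aexp g a ?i"
    by (simp add: c Aexp_def)
  finally have T: "Phi g (\<Prod>b | adj g a b.
          if tt g a = tt g b then Qfun g b (Suc j)
          else if tt g a < tt g b then Qfun g b (tt g b * Suc j)
          else rvar (Av (Suc j)) ^ nat ((- int (Suc j)) mod int (tt g a)) *
               (\<Prod>s<tt g a. Qfun g b ((Suc j + s) div tt g a)))
      = Qser g a ?i ^ 2 * Yser g a ?i"
    using Q by (simp add: Yser_def)
  show ?thesis
    unfolding Qser_def Qfun.simps(3)[of g a j] Phi_divide Phi_diff T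
    by (simp add: Phi_power Phi_mult Phi_rvar algebra_simps Qser_def)
qed

text \<open>Hermite's identity. Passing from \<open>i\<close> to \<open>Suc i\<close> shifts the
  summands by one place: \<open>i div t\<close> leaves and \<open>(i + t) div t\<close>, one larger,
  enters.\<close>

lemma sum_div_lessThan:
  fixes i t :: nat
  assumes "t > 0"
  shows "(\<Sum>s<t. (i + s) div t) = i"
proof (induction i)
  case 0
  then show ?case by simp
next
  case (Suc i)
  have "(\<Sum>s<t. (Suc i + s) div t) + i div t = (\<Sum>s<Suc t. (i + s) div t)"
    unfolding sum.lessThan_Suc_shift by simp
  also have "\<dots> = Suc i + i div t" using Suc assms by simp
  finally show ?case by simp
qed

text \<open>The hypothesis on Q covers just the indices occurring in T, so that the lemma can be
  applied to the induction hypotheses of the Q-recursion. In the case of a short \<open>a\<close>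
  and a long \<open>b\<close>, Hermite's identity adds up the exponents.\<close>

lemma Tser_lead_series:
  assumes g: "nsl_valid g" and ab: "adj g a b"
    and Q: "\<And>i'. i' = i \<and> tt g a = tt g b \<or> i' = tt g b * i \<and> tt g a < tt g b \<or>
        (\<exists>s<tt g a. i' = (i + s) div tt g a) \<and> tt g b < tt g a
      \<Longrightarrow> Qser g b i' \<in> lead_series g (\<lambda>c. if c = b then - int i' else 0)"
  shows "Tser g a b i \<in> lead_series g (\<lambda>c. if c = b then cartan g b a * int i else 0)"
proof -
  have C: "cartan g b a = (if tt g a < tt g b then - int (tt g b) else - 1)"
    using ab by (auto simp: cartan_def adj_def)
  consider "tt g a = tt g b" | "tt g a < tt g b" | "tt g b < tt g a" by linarith
  then show ?thesis
  proof cases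
    case 1
    then show ?thesis using Q[of i] by (simp add: Tser_def C cong: if_cong)
  next
    case 2
    then show ?thesis using Q[of "tt g b * i"] by (simp add: Tser_def C cong: if_cong)
  next
    case 3
    then have "(\<Prod>s<tt g a. Qser g b ((i + s) div tt g a))
        \<in> lead_series g (\<lambda>c. if c = b then cartan g b a * int i else 0)"
    proof (intro lead_series_prod[of _ _ _ "\<lambda>s c. if c = b then - int ((i + s) div tt g a) else 0"] Q)
      fix c
      have "(\<Sum>s<tt g a. - int ((i + s) div tt g a)) = - int i"
        using sum_div_lessThan[OF tt_pos, of i g a] by (simp add: sum_negf of_nat_sum[symmetric] del: of_nat_sum)
      with 3 show "(if c = b then cartan g b a * int i else 0)
          = (\<Sum>s<tt g a. if c = b then - int ((i + s) div tt g a) else 0)"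
        by (simp add: C)
    qed auto
    with 3 show ?thesis by (simp add: Tser_def)
  qed
qed

lemma lookup_y_expo:
  "Poly_Mapping.lookup (y_expo g c) (Uv b) = (if b \<in> nodes g then \<Sum>a\<in>nodes g. cartan g b a * int (c a) else 0)"
  "Poly_Mapping.lookup (y_expo g c) (Av j) = 0"
  unfolding y_expo_def lookup_sum_pm by (auto simp: lookup_single when_def intro!: sum.cong)

text \<open>The exponents \<open>cartan g b a * i\<close> of the neighbouring T and
  \<open>2 * i\<close> from the denominator form column \<open>a\<close> of the Cartan matrix: Y is
  y_a^i times a coefficient monomial and a unit series. Its degree is thus at least
  \<open>y_wt g a * i\<close>, which is positive.\<close>

lemma Yser_cone_series:
  assumes g: "nsl_valid g" and a: "a \<in> nodes g" and i: "i > 0"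
    and Q: "Qser g a i \<in> lead_series g (\<lambda>c. if c = a then - int i else 0)"
    and T: "\<And>b. adj g a b \<Longrightarrow>
      Tser g a b i \<in> lead_series g (\<lambda>c. if c = b then cartan g b a * int i else 0)"
  shows "Yser g a i \<in> cone_series g 0" "\<And>n. n \<le> 0 \<Longrightarrow> Yser g a i $$ n = 0"
proof -
  define c where "c = (\<lambda>b. if b = a then i else 0)"
  define X where "X = (\<Prod>b | adj g a b. Tser g a b i) / Qser g a i ^ 2"
  have T': "(\<Prod>b | adj g a b. Tser g a b i) \<in>
      lead_series g (\<lambda>c. if adj g a c then cartan g c a * int i else 0)"
    using T by (rule lead_series_prod) auto
  have Q': "Qser g a i ^ 2 \<in> lead_series g (\<lambda>c. if c = a then - 2 * int i else 0)"
    using Q by (rule lead_series_power) auto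
  have "X \<in> lead_series g (\<lambda>b. Poly_Mapping.lookup (y_expo g c) (Uv b))"
    unfolding X_def using T' Q'
  proof (rule lead_series_divide)
    fix b
    have "(\<Sum>a'\<in>nodes g. cartan g b a' * int (c a')) = cartan g b a * int i"
    proof -
      have "(\<Sum>a'\<in>nodes g. cartan g b a' * int (c a'))
          = (\<Sum>a'\<in>nodes g. if a' = a then cartan g b a * int i else 0)"
        by (intro sum.cong) (auto simp: c_def)
      then show ?thesis using a by simp
    qed
    then show "Poly_Mapping.lookup (y_expo g c) (Uv b) =
        (if adj g a b then cartan g b a * int i else 0) - (if b = a then - 2 * int i else 0)"
      using a by (auto simp: lookup_y_expo cartan_def adj_def)
  qed
  then obtain d G where d: "G \<in> unit_series g" "X = monom_fls g d 1 * G"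
    "\<And>b. Poly_Mapping.lookup d (Uv b) = Poly_Mapping.lookup (y_expo g c) (Uv b)"
    "\<And>j. Poly_Mapping.lookup d (Av j) = 0"
    unfolding lead_series_def by blast
  have A: "Aser g i ^ n = monom_fls g (Poly_Mapping.single (Av i) (int n)) 1" for n
    by (induction n) (simp_all add: monom_fls_mult single_add[symmetric])
  define e where "e = Poly_Mapping.single (Av i) (int (Aexp g a i)) + d"
  have Y: "Yser g a i = monom_fls g e 1 * G"
  proof -
    have "Yser g a i = Aser g i ^ Aexp g a i * X" by (simp add: Yser_def X_def)
    then show ?thesis unfolding A d(2) mult.assoc[symmetric] monom_fls_mult e_def by simp
  qed
  define f where "f = e - y_expo g c"
  have f: "f \<in> coeff_expos"
    by (auto simp: coeff_expos_def f_def e_def lookup_minus lookup_add lookup_single lookup_y_expo(2) d when_def)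
  have e: "e = 0 + y_expo g c + f" by (simp add: f_def)
  have G: "G \<in> cone_series g 0" using d by (simp add: unit_series_def)
  have "monom_fls g e 1 \<in> cone_series g 0" by (rule monom_fls_cone_series) (use e f in \<open>auto simp: cone_def\<close>)
  then show "Yser g a i \<in> cone_series g 0"
    unfolding Y using cone_series_mult[OF _ G, of _ 0] by simp
  have "(\<Sum>a'\<in>nodes g. y_wt g a' * int (c a')) = (\<Sum>a'\<in>nodes g. if a' = a then y_wt g a * int i else 0)"
    by (intro sum.cong) (auto simp: c_def)
  then have "u_wt g e = y_wt g a * int i"
    unfolding e wt_add wt_coeff[OF f] wt_y_expo using a by simp
  then have "u_wt g e > 0" using y_wt_pos[OF g a] i by simp
  then show "Yser g a i $$ n = 0" if "n \<le> 0" for n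
    unfolding Y monom_fls_times_nth using cone_series_0_nth_neg[OF g G] that by simp
qed

text \<open>Since Y has positive degree, \<open>1 - Y\<close> is a unit series and leaves the
  leading u-exponents alone; these then follow i + 1 = 2 i - (i - 1).\<close>

lemma Qser_lead_series:
  assumes "nsl_valid g" "a \<in> nodes g"
  shows "Qser g a i \<in> lead_series g (\<lambda>c. if c = a then - int i else 0)"
  using assms
proof (induction g a i rule: Qfun.induct)
  case (1 g a)
  then show ?case using lead_series_unit[OF one_unit_series] by (simp cong: if_cong)
next
  case (2 g a)
  then show ?case unfolding Qser_1 lead_series_def
    by (intro CollectI exI[of _ "- Poly_Mapping.single (Uv a) 1"] bexI[of _ 1])
       (auto simp: lookup_single when_def)
next
  case (3 g a j)
  note IH = "3.IH" and g = "3.prems"(1) and a = "3.prems"(2)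
  have Q1: "Qser g a (Suc j) \<in> lead_series g (\<lambda>c. if c = a then - int (Suc j) else 0)"
    using IH g a by blast
  have Q0: "Qser g a j \<in> lead_series g (\<lambda>c. if c = a then - int j else 0)"
    using IH g a by blast
  have T: "Tser g a b (Suc j) \<in> lead_series g (\<lambda>c. if c = b then cartan g b a * int (Suc j) else 0)"
    if ab: "adj g a b" for b
  proof (rule Tser_lead_series[OF g ab])
    fix i'
    assume "i' = Suc j \<and> tt g a = tt g b \<or> i' = tt g b * Suc j \<and> tt g a < tt g b \<or>
        (\<exists>s<tt g a. i' = (Suc j + s) div tt g a) \<and> tt g b < tt g a"
    then consider "i' = Suc j" "tt g a = tt g b" | "i' = tt g b * Suc j" "tt g a < tt g b"
      | s where "s < tt g a" "i' = (Suc j + s) div tt g a" "tt g b < tt g a"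
      by blast
    then show "Qser g b i' \<in> lead_series g (\<lambda>c. if c = b then - int i' else 0)"
    proof cases
      case 1
      show ?thesis unfolding 1(1) by (rule IH(2)) (use 1 g ab adj_nodes[OF ab] in auto)
    next
      case 2
      show ?thesis unfolding 2(1) by (rule IH(3)) (use 2 g ab adj_nodes[OF ab] in auto)
    next
      case 3
      show ?thesis unfolding 3(2) by (rule IH(4)) (use 3 g ab adj_nodes[OF ab] in auto)
    qed
  qed
  have Y: "Yser g a (Suc j) \<in> cone_series g 0" "\<And>n. n \<le> 0 \<Longrightarrow> Yser g a (Suc j) $$ n = 0"
    using Yser_cone_series[OF g a _ Q1 T] by auto
  have "Qser g a (Suc j) ^ 2 * (1 - Yser g a (Suc j)) \<in> lead_series g (\<lambda>c. if c = a then - 2 * int (Suc j) else 0)"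
    by (rule lead_series_mult[OF lead_series_power[OF Q1 refl] lead_series_unit[OF unit_series_1_minus[OF Y]]]) auto
  moreover have "UUser g a (Suc j) * Qser g a j \<in> lead_series g (\<lambda>c. if c = a then - int j else 0)"
    by (rule lead_series_mult[OF monom_fls_UU_lead_series Q0]) simp
  ultimately show ?case
    unfolding Qser_Suc_Suc[OF g lead_series_nonzero[OF Q1]]
    by (rule lead_series_divide) auto
qed

lemma Qser_nonzero: "nsl_valid g \<Longrightarrow> a \<in> nodes g \<Longrightarrow> Qser g a i \<noteq> 0"
  using Qser_lead_series lead_series_nonzero by blast

lemma Yser_expandable:
  assumes g: "nsl_valid g" "a \<in> nodes g" "i > 0"
  shows "Yser g a i \<in> cone_series g 0" "\<And>n. n \<le> 0 \<Longrightarrow> Yser g a i $$ n = 0"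
  using Yser_cone_series[OF assms Qser_lead_series[OF assms(1,2)]]
    Tser_lead_series[OF assms(1)] Qser_lead_series[OF assms(1)] adj_nodes by blast+

subsection \<open>Summing out the partition function\<close>

text \<open>Symmetrisability: 1 / t_a is proportional to (a,a), so both sides are proportional to
  t_a t_b (a,b).\<close>

lemma cartan_tt:
  assumes "nsl_valid g"
  shows "cartan g a b * int (tt g b) = cartan g b a * int (tt g a)"
  using tt_adj[OF assms, of a b] by (auto simp: cartan_def adj_def min_def split: if_splits)

text \<open>Non-zero entries satisfy C_ab : C_ba = t_a : t_b, which turns the cut-off of
  \<open>q_part\<close> into a comparison of the slopes j / t_b and i / t_a.\<close>

lemma cartan_less_iff:
  assumes "nsl_valid g"
  shows "\<bar>cartan g b a\<bar> * int i < \<bar>cartan g a b\<bar> * int j \<longleftrightarrow>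
    cartan g a b \<noteq> 0 \<and> tt g b * i < tt g a * j"
proof -
  have pos: "tt g a > 0" "tt g b > 0" by (rule tt_pos)+
  consider "a = b" | "a \<noteq> b" "\<not> adj g a b" | "a \<noteq> b" "adj g a b" by blast
  then show ?thesis
  proof cases
    case 1
    then show ?thesis using pos by (auto simp: cartan_def)
  next
    case 2
    then show ?thesis by (auto simp: cartan_def adj_def)
  next
    case 3
    then have "adj g b a" by (auto simp: adj_def)
    then show ?thesis using 3 pos tt_adj[OF assms, of a b]
      by (cases "tt g a" "tt g b" rule: linorder_cases)
         (auto simp: cartan_def of_nat_mult[symmetric] simp del: of_nat_mult)
  qed
qed

lemma finite_Jset [simp]: "finite (Jset g k)"
  by (simp add: Jset_def)

text \<open>\<open>C_ab\<close> and \<open>C_ba\<close> have the same sign, so \<open>sgn\<close>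
  removes the absolute values. Pairs of unconnected nodes may pass the slope test, but contribute
  0.\<close>

lemma q_part_eq:
  assumes "nsl_valid g"
  shows "q_part g k l n m a i = int (l a)
    + (\<Sum>(b, j)\<in>Jset g k. if tt g b * i < tt g a * j
         then (cartan g a b * int j - cartan g b a * int i) * int (m b j) else 0)
    - (\<Sum>j = i + 1..tt g a * k. (int j - int i) * int (n a j))"
proof -
  let ?S = "{(b, j). (b, j) \<in> Jset g k \<and> \<bar>cartan g a b\<bar> * int j > \<bar>cartan g b a\<bar> * int i}"
  have sgn: "sgn (cartan g a b) * (\<bar>cartan g a b\<bar> * int j - \<bar>cartan g b a\<bar> * int i)
      = cartan g a b * int j - cartan g b a * int i" for b j
    using tt_pos[of g a] tt_pos[of g b] by (auto simp: cartan_def adj_def sgn_if)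
  have zero: "cartan g a b = 0 \<Longrightarrow> cartan g b a = 0" for b
    using tt_pos[of g a] tt_pos[of g b] by (auto simp: cartan_def adj_def split: if_splits)
  have "(\<Sum>(b, j)\<in>?S. sgn (cartan g a b) * (\<bar>cartan g a b\<bar> * int j - \<bar>cartan g b a\<bar> * int i) * int (m b j))
      = (\<Sum>(b, j)\<in>?S. if tt g b * i < tt g a * j
         then (cartan g a b * int j - cartan g b a * int i) * int (m b j) else 0)"
    unfolding sgn by (intro sum.cong) (auto simp: cartan_less_iff[OF assms])
  also have "\<dots> = (\<Sum>(b, j)\<in>Jset g k. if tt g b * i < tt g a * j
         then (cartan g a b * int j - cartan g b a * int i) * int (m b j) else 0)"
    by (intro sum.mono_neutral_left) (auto simp: cartan_less_iff[OF assms] zero split: if_splits)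
  moreover have "(\<Sum>j = i + 1..tt g a * k. int (j - i) * int (n a j))
      = (\<Sum>j = i + 1..tt g a * k. (int j - int i) * int (n a j))"
    by (intro sum.cong) (auto simp: of_nat_diff)
  ultimately show ?thesis unfolding q_part_def by simp
qed

section \<open>Partially summed terms and the elimination of one variable\<close>

definition remaining :: "nsl_type \<Rightarrow> nat \<Rightarrow> (nat \<Rightarrow> nat) \<Rightarrow> (nat \<times> nat) set" where
  "remaining g k s = {(a, j) \<in> Jset g k. s a < j}"

definition families :: "nsl_type \<Rightarrow> nat \<Rightarrow> (nat \<Rightarrow> nat) \<Rightarrow> (nat \<Rightarrow> nat \<Rightarrow> nat) set" where
  "families g k s = {m. \<forall>a j. (a, j) \<notin> remaining g k s \<longrightarrow> m a j = 0}"

text \<open>Unlike \<open>q_part\<close>, the sum is not cut off at the slope of \<open>(a, x)\<close>: short variables between two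
  multiples of \<open>tt_short g\<close> enter with the opposite sign, and these terms are needed for the power of the
  earlier of the two long functions \<open>Q\<close> in \<open>\<T>\<^sup>(\<^sup>\<gamma>\<^sup>'\<^sup>,\<^sup>\<gamma>\<^sup>)\<close>.\<close>
definition q_lin :: "nsl_type \<Rightarrow> nat \<Rightarrow> (nat \<Rightarrow> nat) \<Rightarrow> (nat \<Rightarrow> nat \<Rightarrow> nat) \<Rightarrow>
    (nat \<Rightarrow> nat) \<Rightarrow> (nat \<Rightarrow> nat \<Rightarrow> nat) \<Rightarrow> nat \<Rightarrow> int \<Rightarrow> int" where
  "q_lin g k l n s m a x = int (l a)
    + (\<Sum>(b, j)\<in>remaining g k s. (cartan g a b * int j - cartan g b a * x) * int (m b j))
    - (\<Sum>j = s a + 1..tt g a * k. (int j - x) * int (n a j))"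

definition boundary_factor :: "nsl_type \<Rightarrow> nat \<Rightarrow> (nat \<Rightarrow> nat) \<Rightarrow> (nat \<Rightarrow> nat \<Rightarrow> nat) \<Rightarrow>
    (nat \<Rightarrow> nat) \<Rightarrow> (nat \<Rightarrow> nat \<Rightarrow> nat) \<Rightarrow> nat \<Rightarrow> ratfun fls" where
  "boundary_factor g k l n s m a =
     Qser g a (s a) powi q_lin g k l n s m a (int (s a) + 1) *
     Qser g a (s a + 1) powi (- q_lin g k l n s m a (int (s a)))"

definition bulk_factor :: "nsl_type \<Rightarrow> nat \<Rightarrow> (nat \<Rightarrow> nat) \<Rightarrow> (nat \<Rightarrow> nat \<Rightarrow> nat) \<Rightarrow>
    (nat \<Rightarrow> nat \<Rightarrow> nat) \<Rightarrow> nat \<times> nat \<Rightarrow> ratfun fls" where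
  "bulk_factor g k l n m = (\<lambda>(a, j).
     monom_fls g 0 (gbin (m a j) (q_part g k l n m a j)) * UUser g a j powi q_part g k l n m a j
       * Aser g j ^ (Aexp g a j * m a j))"

definition done_factor :: "nsl_type \<Rightarrow> (nat \<Rightarrow> nat \<Rightarrow> nat) \<Rightarrow> nat \<times> nat \<Rightarrow> ratfun fls" where
  "done_factor g n = (\<lambda>(a, j). Qser g a j ^ n a j / (1 - Yser g a j))"

definition partial_term :: "nsl_type \<Rightarrow> nat \<Rightarrow> (nat \<Rightarrow> nat) \<Rightarrow> (nat \<Rightarrow> nat \<Rightarrow> nat) \<Rightarrow>
    (nat \<Rightarrow> nat) \<Rightarrow> (nat \<Rightarrow> nat \<Rightarrow> nat) \<Rightarrow> ratfun fls" where
  "partial_term g k l n s m =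
     (\<Prod>p\<in>Jset g k - remaining g k s. done_factor g n p)
     * (\<Prod>a\<in>nodes g. boundary_factor g k l n s m a)
     * (\<Prod>p\<in>remaining g k s. bulk_factor g k l n m p)"

lemma finite_remaining [simp]: "finite (remaining g k s)"
  by (rule finite_subset[of _ "Jset g k"]) (auto simp: remaining_def)

text \<open>The elimination step at the node itself: \<open>q0\<close>, \<open>q1\<close>,
  \<open>q2\<close> are Q at s_a, s_a + 1, s_a + 2 and \<open>R0\<close>, \<open>R1\<close>,
  \<open>R2\<close> the values of the affine exponent there. The term \<open>2 * int x\<close> comes
  from C_aa, and \<open>n\<close> is the exponent that passes to the finished factor.\<close>

lemma powi_Q_recursion:
  fixes q0 q1 q2 u y :: "'a::field"
  assumes "q0 \<noteq> 0" "q1 \<noteq> 0" "u \<noteq> 0" "y \<noteq> 1" "q2 = q1 ^ 2 * (1 - y) / (u * q0)" "R2 = 2 * R1 - R0"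
  shows "q0 powi R1 * q1 powi (- (R0 + 2 * int x - int n)) * u powi R1 =
    q1 powi R2 * q2 powi (- R1) * (1 - y) powi R1 * q1 ^ n * inverse (q1 ^ 2) ^ x"
proof -
  have "(q1 ^ 2) powi (- R1) = q1 powi (- 2 * R1)"
    by (simp add: power_int_mult[symmetric] power_int_minus power_int_power)
  then have "q2 powi (- R1) = q1 powi (- 2 * R1) * (1 - y) powi (- R1) * u powi R1 * q0 powi R1"
    unfolding assms(5) power_int_divide_distrib power_int_mult_distrib
    by (simp only: power_int_minus[of u] power_int_minus[of q0]) (simp add: divide_inverse ac_simps)
  moreover have "inverse (q1 ^ 2) ^ x = q1 powi (- 2 * int x)"
    by (simp add: power_int_minus power_mult[symmetric] power_inverse power_int_def nat_mult_distrib)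
  moreover have "q1 powi (- (R0 + 2 * int x - int n))
      = q1 powi R2 * q1 powi (- 2 * R1) * q1 powi (int n) * q1 powi (- 2 * int x)"
    using assms(2) by (simp add: assms(6) power_int_add[symmetric] algebra_simps del: power_int_of_nat)
  moreover have "(1 - y) powi (- R1) * (1 - y) powi R1 = 1"
    using assms(4) by (simp add: power_int_add[symmetric])
  ultimately show ?thesis by (simp add: algebra_simps)
qed

text \<open>The hypotheses say i / t_b \<le> p / t_a \<le> (i + 1) / t_b. Unless \<open>b\<close> is
  the longer root, \<open>p * tt g b div tt g a\<close> is exactly \<open>i\<close> or
  \<open>i + 1\<close> and one of the two powers is trivial. If it is, the floors in T take only the
  values \<open>i\<close> and \<open>i + 1\<close>, and the exponents count how often.\<close>

lemma Tser_eq_powi: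
  assumes g: "nsl_valid g" and ab: "adj g a b"
    and le: "i * tt g a \<le> p * tt g b" "p * tt g b \<le> (i + 1) * tt g a"
  shows "Qser g b i powi (cartan g b a * int p - cartan g a b * (int i + 1))
    * Qser g b (i + 1) powi (- (cartan g b a * int p - cartan g a b * int i)) = Tser g a b p"
proof -
  have ba: "adj g b a" "a \<noteq> b" "b \<noteq> a" using ab by (auto simp: adj_def)
  have pos: "tt g a > 0" "tt g b > 0" by (rule tt_pos)+
  have min: "tt g a \<noteq> tt g b \<Longrightarrow> min (tt g a) (tt g b) = 1" using tt_adj[OF g ab] by blast
  consider "tt g a = tt g b" | "tt g a < tt g b" | "tt g b < tt g a" by linarith
  then show ?thesis
  proof cases
    case 1
    have "i \<le> p" "p \<le> i + 1" using le pos unfolding 1 mult_le_cancel2 by simp_all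
    then have "p = i \<or> p = i + 1" by auto
    then show ?thesis using 1 ab ba by (auto simp: Tser_def cartan_def)
  next
    case 2
    then have "p * tt g b = i \<or> p * tt g b = i + 1" using le min by auto
    then show ?thesis
    proof
      assume p: "p * tt g b = i"
      then have "int i = int (tt g b) * int p" by (metis mult.commute of_nat_mult)
      with p 2 ab ba show ?thesis by (simp add: Tser_def cartan_def mult.commute)
    next
      assume p: "p * tt g b = i + 1"
      then have "int i + 1 = int (tt g b) * int p" by (metis mult.commute of_nat_mult of_nat_1 of_nat_add)
      then have "int i = int (tt g b) * int p - 1" by simp
      with p 2 ab ba show ?thesis by (simp add: Tser_def cartan_def mult.commute)
    qed
  next
    case 3
    then have b: "tt g b = 1" using min by simp
    define t where "t = tt g a"
    \<comment> \<open>\<open>r\<close> of the \<open>t\<close> floors have already jumped to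
      \<open>i + 1\<close>.\<close>
    define r where "r = p - t * i"
    have p: "p = t * i + r" "r \<le> t" using le b by (auto simp: r_def t_def algebra_simps)
    have dv: "(p + s) div t = (if s < t - r then i else i + 1)" if "s < t" for s
      using that p(2) by (auto simp: p(1) intro!: div_nat_eqI)
    have "(\<Prod>s<t. Qser g b ((p + s) div t)) = (\<Prod>s<t. if s < t - r then Qser g b i else Qser g b (i + 1))"
      by (intro prod.cong) (auto simp: dv)
    also have "\<dots> = Qser g b i ^ (t - r) * Qser g b (i + 1) ^ r"
    proof -
      have "{..<t} \<inter> {s. s < t - r} = {..<t - r}" "{..<t} \<inter> - {s. s < t - r} = {t - r..<t}" by auto
      then show ?thesis using p(2) by (simp add: prod.If_cases)
    qed
    also have "\<dots> = Qser g b i powi (int t * (int i + 1) - int p) * Qser g b (i + 1) powi (int p - int t * int i)"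
    proof -
      have "int t * (int i + 1) - int p = int (t - r)" "int p - int t * int i = int r"
        using p(2) by (simp_all add: p(1) of_nat_diff algebra_simps)
      then show ?thesis by simp
    qed
    finally show ?thesis using 3 ab ba by (simp add: Tser_def cartan_def t_def)
  qed
qed

text \<open>By \<open>le\<close> the slope p / t_a lies, on every node, between those of the last
  index done and the next one. Ties are allowed on both sides, so the order among variables of equal
  slope is free.\<close>

lemma
  assumes g: "nsl_valid g" and a: "a \<in> nodes g" and p: "p = s a + 1" "p \<le> tt g a * k"
    and le: "\<And>b. b \<in> nodes g \<Longrightarrow> s b * tt g a \<le> p * tt g b"
      "\<And>b. b \<in> nodes g \<Longrightarrow> p * tt g b \<le> (s b + 1) * tt g a"
    and sm: "fls_summable (families g k s) (partial_term g k l n s)"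
  shows partial_term_summable_step:
      "fls_summable (families g k (s(a := p))) (partial_term g k l n (s(a := p)))"
    and partial_term_infsum_step:
      "fls_infsum (families g k s) (partial_term g k l n s) =
       fls_infsum (families g k (s(a := p))) (partial_term g k l n (s(a := p)))"
proof -
  define s' where "s' = s(a := p)"
  define upd where "upd m x = (\<lambda>b j. if b = a \<and> j = p then x else m b j)" for m :: "nat \<Rightarrow> nat \<Rightarrow> nat" and x
  define Y where "Y = Yser g a p"
  define R where "R m = q_lin g k l n s' m a (int p)" for m
  have J: "(a, p) \<in> Jset g k" using a p by (simp add: Jset_def)
  have rem: "remaining g k s = insert (a, p) (remaining g k s')" "(a, p) \<notin> remaining g k s'"
    using J p by (auto simp: remaining_def s'_def split: if_splits)
  have dn: "Jset g k - remaining g k s' = insert (a, p) (Jset g k - remaining g k s)"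
    "(a, p) \<notin> Jset g k - remaining g k s"
    using J rem by auto
  have updfam: "upd m x \<in> families g k s" if "m \<in> families g k s'" for m x
    using that rem by (auto simp: families_def upd_def)
  have bij: "bij_betw (\<lambda>(m, x). upd m x) (families g k s' \<times> UNIV) (families g k s)"
  proof (rule bij_betw_byWitness[where f' = "\<lambda>m. (upd m 0, m a p)"])
    show "\<forall>y\<in>families g k s' \<times> UNIV. (upd (case y of (m, x) \<Rightarrow> upd m x) 0, (case y of (m, x) \<Rightarrow> upd m x) a p) = y"
      using rem(2) by (fastforce simp: families_def upd_def fun_eq_iff)
    show "\<forall>m\<in>families g k s. (case (upd m 0, m a p) of (m, x) \<Rightarrow> upd m x) = m"
      by (auto simp: upd_def fun_eq_iff)
    show "(\<lambda>(m, x). upd m x) ` (families g k s' \<times> UNIV) \<subseteq> families g k s" using updfam by auto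
    show "(\<lambda>m. (upd m 0, m a p)) ` families g k s \<subseteq> families g k s' \<times> UNIV"
      using rem by (auto simp: families_def upd_def)
  qed
  have q_lin_upd: "q_lin g k l n s (upd m x) b y = q_lin g k l n s' m b y
      + (cartan g b a * int p - cartan g a b * y) * int x
      - (if b = a then (int p - y) * int (n a p) else 0)" for m x b y
  proof -
    have "(\<Sum>(c, j)\<in>remaining g k s'. (cartan g b c * int j - cartan g c b * y) * int (upd m x c j))
        = (\<Sum>(c, j)\<in>remaining g k s'. (cartan g b c * int j - cartan g c b * y) * int (m c j))"
      using rem(2) by (intro sum.cong) (auto simp: upd_def)
    then have "(\<Sum>(c, j)\<in>remaining g k s. (cartan g b c * int j - cartan g c b * y) * int (upd m x c j))
        = (cartan g b a * int p - cartan g a b * y) * int x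
          + (\<Sum>(c, j)\<in>remaining g k s'. (cartan g b c * int j - cartan g c b * y) * int (m c j))"
      unfolding rem(1) using rem(2) by (simp add: upd_def)
    moreover have "(\<Sum>j = s b + 1..tt g b * k. (int j - y) * int (n b j))
        = (\<Sum>j = s' b + 1..tt g b * k. (int j - y) * int (n b j))
          + (if b = a then (int p - y) * int (n a p) else 0)"
      using p by (auto simp: s'_def sum.atLeast_Suc_atMost)
    ultimately show ?thesis by (simp add: q_lin_def)
  qed
  \<comment> \<open>The sums in \<open>q_part\<close> and \<open>q_lin\<close> differ by remaining
    variables of the same slope as (a, p) only, and their coefficients vanish by
    \<open>cartan_tt\<close>. The eliminated value \<open>x\<close> does not enter, as the cut-off
    is strict.\<close>
  have q_part_p: "q_part g k l n (upd m x) a p = R m" for m x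
  proof -
    have eq: "(if tt g b * p < tt g a * j
          then (cartan g a b * int j - cartan g b a * int p) * int (upd m x b j) else 0)
        = (if (b, j) \<in> remaining g k s' then (cartan g a b * int j - cartan g b a * int p) * int (m b j) else 0)"
      if bj: "(b, j) \<in> Jset g k" for b j
    proof (cases "b = a")
      case True
      then show ?thesis using bj tt_pos[of g a] by (auto simp: upd_def remaining_def s'_def)
    next
      case False
      have b: "b \<in> nodes g" using bj by (simp add: Jset_def)
      show ?thesis
      proof (cases "tt g b * p < tt g a * j")
        case True
        have "s b * tt g a < j * tt g a"
          by (rule le_less_trans[OF le(1)[OF b]]) (use True in \<open>simp only: mult.commute\<close>)
        then show ?thesis using True False bj by (auto simp: upd_def remaining_def s'_def)
      next
        case ge: False
        show ?thesis
        proof (cases "s b < j")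
          case True
          then have "(s b + 1) * tt g a \<le> j * tt g a" by (intro mult_right_mono) auto
          then have "tt g b * p = tt g a * j" using le(2)[OF b] ge by (simp add: mult.commute)
          then have tp: "int (tt g b) * int p = int (tt g a) * int j" by (metis of_nat_mult)
          have "(cartan g a b * int j - cartan g b a * int p) * int (tt g b) =
            cartan g a b * int (tt g b) * int j - cartan g b a * (int (tt g b) * int p)"
            by (simp add: algebra_simps)
          also have "\<dots> = (cartan g a b * int (tt g b) - cartan g b a * int (tt g a)) * int j"
            unfolding tp by (simp add: algebra_simps)
          also have "\<dots> = 0" by (simp add: cartan_tt[OF g, of a b])
          finally have "cartan g a b * int j - cartan g b a * int p = 0" using tt_pos[of g b] by simp
          then show ?thesis using ge by simp
        next
          case False
          then show ?thesis using ge \<open>b \<noteq> a\<close> by (auto simp: remaining_def s'_def)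
        qed
      qed
    qed
    have "(\<Sum>(b, j)\<in>Jset g k. if tt g b * p < tt g a * j
         then (cartan g a b * int j - cartan g b a * int p) * int (upd m x b j) else 0)
      = (\<Sum>(b, j)\<in>Jset g k. if (b, j) \<in> remaining g k s'
         then (cartan g a b * int j - cartan g b a * int p) * int (m b j) else 0)"
      using eq by (intro sum.cong) auto
    also have "\<dots> = (\<Sum>(b, j)\<in>remaining g k s'. (cartan g a b * int j - cartan g b a * int p) * int (m b j))"
      by (rule sum.mono_neutral_cong_right) (auto simp: remaining_def split: if_splits)
    finally show ?thesis
      by (simp add: q_part_eq[OF g] R_def q_lin_def s'_def)
  qed
  \<comment> \<open>No remaining variable has smaller slope than (a, p), whereas
    \<open>q_part\<close> counts strictly larger slopes only; so m_(a,p) is absent from these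
    exponents.\<close>
  have q_part_rem: "q_part g k l n (upd m x) b j = q_part g k l n m b j"
    if "(b, j) \<in> remaining g k s'" for m x b j
  proof -
    have b: "b \<in> nodes g" using that by (simp add: remaining_def Jset_def)
    have "\<not> tt g a * j < tt g b * p"
    proof (cases "b = a")
      case True
      then show ?thesis using that by (simp add: remaining_def s'_def)
    next
      case False
      then have "(s b + 1) * tt g a \<le> j * tt g a"
        using that by (intro mult_right_mono) (auto simp: remaining_def s'_def)
      then show ?thesis using le(2)[OF b] by (simp add: mult.commute)
    qed
    then show ?thesis unfolding q_part_eq[OF g]
      by (intro arg_cong2[of _ _ _ _ "(-)"] arg_cong2[of _ _ _ _ "(+)"] sum.cong) (auto simp: upd_def)
  qed
  have Qnz: "Qser g b i \<noteq> 0" if "b \<in> nodes g" for b i using Qser_nonzero[OF g that] .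
  have Y: "Y \<in> cone_series g 0" "\<And>n. n \<le> 0 \<Longrightarrow> Y $$ n = 0"
    using Yser_expandable[OF g a, of p] p by (auto simp: Y_def)
  have Y1: "1 - Y \<noteq> 0" using Y(2)[of 0] by auto
  have bulk: "(\<Prod>q\<in>remaining g k s. bulk_factor g k l n (upd m x) q) =
      monom_fls g 0 (gbin x (R m)) * UUser g a p powi R m * (Aser g p ^ Aexp g a p) ^ x
      * (\<Prod>q\<in>remaining g k s'. bulk_factor g k l n m q)" for m x
  proof -
    have "(\<Prod>q\<in>remaining g k s'. bulk_factor g k l n (upd m x) q) = (\<Prod>q\<in>remaining g k s'. bulk_factor g k l n m q)"
      using rem(2) q_part_rem by (intro prod.cong) (auto simp: bulk_factor_def upd_def)
    moreover have "bulk_factor g k l n (upd m x) (a, p) =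
        monom_fls g 0 (gbin x (R m)) * UUser g a p powi R m * (Aser g p ^ Aexp g a p) ^ x"
      by (simp add: bulk_factor_def q_part_p power_mult[symmetric]) (simp add: upd_def)
    ultimately show ?thesis unfolding rem(1) using rem(2) by simp
  qed
  have bdry: "boundary_factor g k l n s (upd m x) b = boundary_factor g k l n s' m b
      * (if adj g a b then Tser g a b p else 1) ^ x" if b: "b \<in> nodes g" "b \<noteq> a" for m x b
  proof -
    let ?e = "\<lambda>y. cartan g b a * int p - cartan g a b * y"
    have "boundary_factor g k l n s (upd m x) b = boundary_factor g k l n s' m b
        * (Qser g b (s b) powi ?e (int (s b) + 1) * Qser g b (s b + 1) powi (- ?e (int (s b)))) ^ x"
    proof -
      have s: "s' b = s b" using b by (simp add: s'_def)
      have pw: "z powi (y + w * int x) = z powi y * (z powi w) ^ x"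
        "z powi (- (y + w * int x)) = z powi (- y) * (z powi (- w)) ^ x"
        if "z \<noteq> 0" for z :: "ratfun fls" and y w
        using that power_int_add[of z "- y" "- (w * int x)"] power_int_mult[of z "- w" "int x"]
        by (simp_all add: power_int_add power_int_mult)
      show ?thesis
        unfolding boundary_factor_def q_lin_upd s using b
        by (simp only: if_False diff_0_right pw[OF Qnz] power_mult_distrib) (simp add: ac_simps)
    qed
    also have "Qser g b (s b) powi ?e (int (s b) + 1) * Qser g b (s b + 1) powi (- ?e (int (s b)))
        = (if adj g a b then Tser g a b p else 1)"
    proof (cases "adj g a b")
      case True
      then show ?thesis using Tser_eq_powi[OF g True le[OF b(1)]] by simp
    next
      case False
      then have "\<not> adj g b a" by (auto simp: adj_def)
      with False show ?thesis using b by (simp add: cartan_def)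
    qed
    finally show ?thesis .
  qed
  have bdry_a: "boundary_factor g k l n s (upd m x) a * UUser g a p powi R m
      = boundary_factor g k l n s' m a * (1 - Y) powi R m * Qser g a p ^ n a p * inverse (Qser g a p ^ 2) ^ x" for m x
  proof -
    have "q_lin g k l n s' m a (int p + 1) = 2 * R m - q_lin g k l n s' m a (int (s a))"
    proof -
      have "q_lin g k l n s' m a (int p + 1) + q_lin g k l n s' m a (int (s a)) - 2 * R m = 0"
        unfolding R_def q_lin_def p(1)
        by (simp add: sum.distrib[symmetric] sum_subtractf[symmetric] sum_distrib_left case_prod_beta algebra_simps)
      then show ?thesis by simp
    qed
    moreover have "Qser g a (p + 1) = Qser g a p ^ 2 * (1 - Y) / (UUser g a p * Qser g a (s a))"
      using Qser_Suc_Suc[OF g Qnz[OF a], of "s a"] by (simp add: Y_def p(1))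
    ultimately have "Qser g a (s a) powi R m * Qser g a p powi
        (- (q_lin g k l n s' m a (int (s a)) + 2 * int x - int (n a p))) * UUser g a p powi R m
      = Qser g a p powi q_lin g k l n s' m a (int p + 1) * Qser g a (p + 1) powi (- R m)
        * (1 - Y) powi R m * Qser g a p ^ n a p * inverse (Qser g a p ^ 2) ^ x"
      using Y1 by (intro powi_Q_recursion Qnz[OF a]) auto
    moreover have "int (s a) + 1 = int p" by (simp add: p(1))
    then have "q_lin g k l n s (upd m x) a (int (s a) + 1) = R m"
      by (simp only: q_lin_upd R_def) (simp add: cartan_def)
    moreover have "q_lin g k l n s (upd m x) a (int (s a))
        = q_lin g k l n s' m a (int (s a)) + 2 * int x - int (n a p)"
      by (simp add: q_lin_upd p(1) cartan_def algebra_simps)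
    moreover have "boundary_factor g k l n s' m a =
        Qser g a p powi q_lin g k l n s' m a (int p + 1) * Qser g a (p + 1) powi (- R m)"
    proof -
      have "s' a = p" by (simp add: s'_def)
      then show ?thesis unfolding boundary_factor_def R_def by (simp only:)
    qed
    ultimately show ?thesis
      unfolding boundary_factor_def[of _ _ _ _ s] p(1)[symmetric] by (simp only:)
  qed
  have Yx: "(\<Prod>b\<in>nodes g - {a}. if adj g a b then Tser g a b p else 1) * inverse (Qser g a p ^ 2)
      * Aser g p ^ Aexp g a p = Y"
  proof -
    have "(\<Prod>b\<in>nodes g - {a}. if adj g a b then Tser g a b p else 1) = (\<Prod>b | adj g a b. Tser g a b p)"
      by (rule prod.mono_neutral_cong_right) (auto simp: adj_def)
    then show ?thesis by (simp add: Y_def Yser_def divide_inverse ac_simps)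
  qed
  \<comment> \<open>All dependence on \<open>x\<close> is now in the second factor. Of the exponent
    \<open>R m + 1\<close>, \<open>R m\<close> comes from the recursion and 1 offsets the factor 1 /
    (1 - Y) that (a, p) brings into \<open>partial_term\<close> as a finished pair.\<close>
  have main: "partial_term g k l n s (upd m x) =
      (partial_term g k l n s' m * (1 - Y) powi (R m + 1)) * (monom_fls g 0 (gbin x (R m)) * Y ^ x)" for m x
  proof -
    define D where "D = (\<Prod>q\<in>Jset g k - remaining g k s. done_factor g n q)"
    define B where "B = (\<Prod>q\<in>remaining g k s'. bulk_factor g k l n m q)"
    define W where "W = (\<Prod>b\<in>nodes g - {a}. boundary_factor g k l n s' m b)"
    define T where "T = (\<Prod>b\<in>nodes g - {a}. if adj g a b then Tser g a b p else 1)"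
    define U where "U = UUser g a p powi R m"
    have W': "(\<Prod>b\<in>nodes g. boundary_factor g k l n s (upd m x) b) =
        boundary_factor g k l n s (upd m x) a * (W * T ^ x)"
    proof -
      have "(\<Prod>b\<in>nodes g - {a}. boundary_factor g k l n s (upd m x) b) = W * T ^ x"
        unfolding W_def T_def prod_power_distrib prod.distrib[symmetric]
        using bdry by (intro prod.cong) auto
      then show ?thesis using a by (subst prod.remove[of _ a]) auto
    qed
    have "partial_term g k l n s (upd m x) =
        D * (boundary_factor g k l n s (upd m x) a * U) * W * T ^ x
        * (monom_fls g 0 (gbin x (R m)) * (Aser g p ^ Aexp g a p) ^ x * B)"
      unfolding partial_term_def W' bulk D_def[symmetric] B_def[symmetric] U_def
      by (simp add: ac_simps)
    also have "\<dots> = D * Qser g a p ^ n a p * (boundary_factor g k l n s' m a * W) * B * (1 - Y) powi R m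
        * (monom_fls g 0 (gbin x (R m)) * (T * inverse (Qser g a p ^ 2) * Aser g p ^ Aexp g a p) ^ x)"
      unfolding U_def bdry_a power_mult_distrib by (simp add: ac_simps)
    also have "T * inverse (Qser g a p ^ 2) * Aser g p ^ Aexp g a p = Y"
      unfolding T_def by (rule Yx)
    also have "D * Qser g a p ^ n a p * (boundary_factor g k l n s' m a * W) * B * (1 - Y) powi R m
        = partial_term g k l n s' m * (1 - Y) powi (R m + 1)"
    proof -
      have "(\<Prod>b\<in>nodes g. boundary_factor g k l n s' m b) = boundary_factor g k l n s' m a * W"
        unfolding W_def using a by (subst prod.remove[of _ a]) auto
      moreover have "(\<Prod>q\<in>Jset g k - remaining g k s'. done_factor g n q) = D * Qser g a p ^ n a p / (1 - Y)"
        unfolding dn(1) using dn(2) by (simp add: D_def done_factor_def Y_def)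
      ultimately show ?thesis
        using Y1 by (simp add: partial_term_def B_def[symmetric] power_int_add_1)
    qed
    finally show ?thesis .
  qed
  have sum_x: "fls_infsum UNIV (\<lambda>x. partial_term g k l n s (upd m x)) = partial_term g k l n s' m" for m
  proof -
    have "fls_infsum UNIV (\<lambda>x. partial_term g k l n s (upd m x)) =
        fls_infsum UNIV (\<lambda>x. (partial_term g k l n s' m * (1 - Y) powi (R m + 1)) * (monom_fls g 0 (gbin x (R m)) * Y ^ x))"
      unfolding main by (rule refl)
    also have "\<dots> = (partial_term g k l n s' m * (1 - Y) powi (R m + 1))
        * fls_infsum UNIV (\<lambda>x. monom_fls g 0 (gbin x (R m)) * Y ^ x)"
      using Y by (intro fls_infsum_cmult summable_gbin)
    also have "fls_infsum UNIV (\<lambda>x. monom_fls g 0 (gbin x (R m)) * Y ^ x) = (1 - Y) powi (- R m - 1)"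
      using Y by (rule infsum_gbin)
    also have "partial_term g k l n s' m * (1 - Y) powi (R m + 1) * (1 - Y) powi (- R m - 1) = partial_term g k l n s' m"
      using Y1 by (simp add: power_int_add[symmetric] mult.assoc)
    finally show ?thesis .
  qed
  have split: "(\<lambda>q. partial_term g k l n s (case q of (m, x) \<Rightarrow> upd m x)) = (\<lambda>(m, x). partial_term g k l n s (upd m x))"
    by auto
  have smx: "fls_summable (families g k s' \<times> UNIV) (\<lambda>(m, x). partial_term g k l n s (upd m x))"
    using sm fls_summable_reindex[OF bij, of "partial_term g k l n s"] unfolding split by simp
  show "fls_summable (families g k (s(a := p))) (partial_term g k l n (s(a := p)))"
    using fls_summable_Times_outer[OF smx] by (simp add: sum_x s'_def)
  show "fls_infsum (families g k s) (partial_term g k l n s) =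
       fls_infsum (families g k (s(a := p))) (partial_term g k l n (s(a := p)))"
    using fls_infsum_Times[OF smx] fls_infsum_reindex[OF bij, of "partial_term g k l n s"]
    unfolding split sum_x s'_def by simp
qed

section \<open>The starting point: the partition function itself\<close>

lemma prod_monom_fls:
  "finite A \<Longrightarrow> (\<Prod>x\<in>A. monom_fls g (e x) (c x)) = monom_fls g (\<Sum>x\<in>A. e x) (\<Prod>x\<in>A. c x)"
  by (induction A rule: finite_induct) (simp_all add: monom_fls_mult)

lemma monom_fls_single_power:
  "monom_fls g (Poly_Mapping.single v x) 1 ^ i = monom_fls g (Poly_Mapping.single v (int i * x)) 1"
  by (induction i) (simp_all add: monom_fls_mult single_add[symmetric] algebra_simps)

lemma monom_fls_single_powi:
  "monom_fls g (Poly_Mapping.single v x) 1 powi z = monom_fls g (Poly_Mapping.single v (z * x)) 1"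
  by (cases z rule: int_cases2)
     (simp_all add: power_int_minus monom_fls_single_power monom_fls_inverse single_uminus[symmetric] del: single_uminus)

lemma remaining_0: "remaining g k (\<lambda>_. 0) = Jset g k"
  by (auto simp: remaining_def Jset_def)

lemma families_0: "families g k (\<lambda>_. 0) = m_families g k"
  by (simp add: families_def m_families_def remaining_0)

lemma partial_term_0: "partial_term g k l n (\<lambda>_. 0) m = monom_fls g (Z_expo g k l n m) (Z_weight g k l n m)"
proof -
  have "q_lin g k l n (\<lambda>_. 0) m a 0 = q_tot g k l n m a" for a
    by (simp add: q_lin_def q_tot_def remaining_0 ac_simps)
  then have bdry: "boundary_factor g k l n (\<lambda>_. 0) m a = monom_fls g (Poly_Mapping.single (Uv a) (q_tot g k l n m a)) 1" for a
    by (simp add: boundary_factor_def Qser_1 single_uminus[symmetric] monom_fls_single_powi)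
  define e where "e = (\<lambda>a j. Poly_Mapping.single (UUv a j) (q_part g k l n m a j)
    + Poly_Mapping.single (Av j) (Delta g m a j))"
  have D: "int (Aexp g a j * m a j) = Delta g m a j" for a j
    using tt_pos[of g "gamma' g"] by (simp add: Aexp_def Delta_def)
  have bulk: "bulk_factor g k l n m (a, j) = monom_fls g (e a j) (gbin (m a j) (q_part g k l n m a j))" for a j
    unfolding bulk_factor_def by (simp add: monom_fls_single_powi monom_fls_single_power monom_fls_mult D[symmetric] e_def)
  have "partial_term g k l n (\<lambda>_. 0) m = monom_fls g (\<Sum>a\<in>nodes g. Poly_Mapping.single (Uv a) (q_tot g k l n m a)) 1
      * monom_fls g (\<Sum>(a, j)\<in>Jset g k. e a j) (\<Prod>(a, j)\<in>Jset g k. gbin (m a j) (q_part g k l n m a j))"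
  proof -
    have "(\<Prod>q\<in>Jset g k. bulk_factor g k l n m q) = (\<Prod>q\<in>Jset g k. monom_fls g (case q of (a, j) \<Rightarrow> e a j)
        (case q of (a, j) \<Rightarrow> gbin (m a j) (q_part g k l n m a j)))"
      by (intro prod.cong) (auto simp: bulk)
    then show ?thesis
      unfolding partial_term_def remaining_0 bdry by (simp add: prod_monom_fls)
  qed
  moreover have "Z_expo g k l n m =
      (\<Sum>a\<in>nodes g. Poly_Mapping.single (Uv a) (q_tot g k l n m a)) + (\<Sum>(a, j)\<in>Jset g k. e a j)"
    by (simp add: Z_expo_def Jset_def sum.Sigma[symmetric] sum.distrib e_def)
  moreover have "Z_weight g k l n m = (\<Prod>(a, j)\<in>Jset g k. gbin (m a j) (q_part g k l n m a j))"
    by (simp add: Z_weight_def Jset_def prod.Sigma)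
  ultimately show ?thesis by (simp add: monom_fls_mult)
qed

lemma u_wt_Z_expo:
  "u_wt g (Z_expo g k l n m) =
     (\<Sum>a\<in>nodes g. ht g a * (int (l a) - (\<Sum>j = 1..tt g a * k. int j * int (n a j))))
     + (\<Sum>(b, j)\<in>Jset g k. (int j * y_wt g b) * int (m b j))"
proof -
  have "Poly_Mapping.lookup (Z_expo g k l n m) (Uv a) = q_tot g k l n m a" if "a \<in> nodes g" for a
    using that by (simp add: Z_expo_def lookup_sum_pm lookup_add lookup_single when_def)
  then have "u_wt g (Z_expo g k l n m) = (\<Sum>a\<in>nodes g. ht g a * q_tot g k l n m a)"
    by (simp add: u_wt_def)
  also have "\<dots> = (\<Sum>a\<in>nodes g. ht g a * (int (l a) - (\<Sum>j = 1..tt g a * k. int j * int (n a j))))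
      + (\<Sum>a\<in>nodes g. \<Sum>p\<in>Jset g k. ht g a * cartan g a (fst p) * (int (snd p) * int (m (fst p) (snd p))))"
    by (simp add: q_tot_def sum.distrib[symmetric] sum_distrib_left case_prod_beta algebra_simps)
  also have "(\<Sum>a\<in>nodes g. \<Sum>p\<in>Jset g k. ht g a * cartan g a (fst p) * (int (snd p) * int (m (fst p) (snd p))))
      = (\<Sum>(b, j)\<in>Jset g k. (int j * y_wt g b) * int (m b j))"
    by (subst sum.swap) (simp add: y_wt_def sum_distrib_left sum_distrib_right case_prod_beta algebra_simps)
  finally show ?thesis .
qed

text \<open>Each unit of \<open>m b j\<close> raises the degree by \<open>j * y_wt g b > 0\<close>.
  Summability needs this bound for all degrees up to \<open>N\<close>, not just finiteness for one
  exponent.\<close>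

lemma finite_families_u_wt_le:
  assumes "nsl_valid g"
  shows "finite {m \<in> m_families g k. u_wt g (Z_expo g k l n m) \<le> N}"
proof -
  define base where "base = (\<Sum>a\<in>nodes g. ht g a * (int (l a) - (\<Sum>j = 1..tt g a * k. int j * int (n a j))))"
  define C where "C = {c :: nat \<times> nat \<Rightarrow> nat. (\<forall>p. p \<notin> Jset g k \<longrightarrow> c p = 0) \<and>
    (\<Sum>p\<in>Jset g k. (int (snd p) * y_wt g (fst p)) * int (c p)) \<le> N - base}"
  have "finite C"
    unfolding C_def using y_wt_pos[OF assms] by (intro finite_bounded_families) (auto simp: Jset_def)
  moreover have "{m \<in> m_families g k. u_wt g (Z_expo g k l n m) \<le> N} \<subseteq> curry ` C"
  proof
    fix m assume "m \<in> {m \<in> m_families g k. u_wt g (Z_expo g k l n m) \<le> N}"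
    moreover have "u_wt g (Z_expo g k l n m) = base + (\<Sum>(b, j)\<in>Jset g k. (int j * y_wt g b) * int (m b j))"
      unfolding base_def by (rule u_wt_Z_expo)
    ultimately have "case_prod m \<in> C"
      by (auto simp: C_def m_families_def case_prod_beta)
    then show "m \<in> curry ` C" by (intro image_eqI[of _ _ "case_prod m"]) auto
  qed
  ultimately show ?thesis by (rule finite_surj)
qed

lemma partial_term_summable_0:
  assumes "nsl_valid g"
  shows "fls_summable (m_families g k) (partial_term g k l n (\<lambda>_. 0))"
  unfolding fls_summable_def
proof
  fix N
  have "{m \<in> m_families g k. \<exists>i\<le>N. partial_term g k l n (\<lambda>_. 0) m $$ i \<noteq> 0}
      \<subseteq> {m \<in> m_families g k. u_wt g (Z_expo g k l n m) \<le> N}"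
    by (auto simp: partial_term_0 monom_fls_nth split: if_splits)
  then show "finite {m \<in> m_families g k. \<exists>i\<le>N. partial_term g k l n (\<lambda>_. 0) m $$ i \<noteq> 0}"
    by (rule finite_subset) (rule finite_families_u_wt_le[OF assms])
qed

lemma ser_infsum_partial_term_0:
  assumes g: "nsl_valid g"
  shows "ser g (fls_infsum (m_families g k) (partial_term g k l n (\<lambda>_. 0))) = Z_series g k l n"
proof
  fix e
  define N where "N = u_wt g e"
  define F where "F = {m \<in> m_families g k. Z_expo g k l n m = e}"
  \<comment> \<open>The fibre \<open>F\<close> may contain families of weight 0, and degree
    \<open>N\<close> may contain families with other exponents; the union accommodates both
    sums.\<close>
  define B where "B = F \<union> {m \<in> m_families g k. partial_term g k l n (\<lambda>_. 0) m $$ N \<noteq> 0}"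
  have B: "finite B"
    using finite_Z_fibre[OF g] fls_summable_finite_nth[OF partial_term_summable_0[OF g]]
    by (simp add: B_def F_def)
  have "fls_infsum (m_families g k) (partial_term g k l n (\<lambda>_. 0)) $$ N
      = (\<Sum>m\<in>B. partial_term g k l n (\<lambda>_. 0) m $$ N)"
    using B by (intro fls_infsum_nth_superset partial_term_summable_0 g) (auto simp: B_def F_def)
  also have "\<dots> = emb (\<Sum>m\<in>B. if N = u_wt g (Z_expo g k l n m)
      then Poly_Mapping.single (Z_expo g k l n m) (Z_weight g k l n m) else 0)"
    by (simp add: partial_term_0 monom_fls_nth emb_sum)
  finally have "ser g (fls_infsum (m_families g k) (partial_term g k l n (\<lambda>_. 0))) e
      = (\<Sum>m\<in>B. Poly_Mapping.lookup (if N = u_wt g (Z_expo g k l n m)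
      then Poly_Mapping.single (Z_expo g k l n m) (Z_weight g k l n m) else 0) e)"
    by (simp add: ser_def N_def lookup_sum_pm)
  also have "\<dots> = (\<Sum>m\<in>F. Z_weight g k l n m)"
    using B by (intro sum.mono_neutral_cong_right)
      (auto simp: B_def F_def N_def lookup_single when_def split: if_splits)
  finally show "ser g (fls_infsum (m_families g k) (partial_term g k l n (\<lambda>_. 0))) e = Z_series g k l n e"
    by (simp add: Z_series_def F_def)
qed

section \<open>The order of summation\<close>

text \<open>The last index on node \<open>b\<close> that has been summed out, when all \<open>(b, j)\<close> with
  \<open>j / tt g b \<le> i / tt_short g\<close> are done and, on the nodes \<open>b \<le> a\<close>, also those with
  \<open>j / tt g b \<le> (i + 1) / tt_short g\<close>.\<close>
definition stage :: "nsl_type \<Rightarrow> nat \<Rightarrow> nat \<Rightarrow> nat \<Rightarrow> nat" where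
  "stage g i a b = (if b \<in> nodes g then (if b \<le> a then i + 1 else i) * tt g b div tt_short g else 0)"

lemma stage_0_0: "stage g 0 0 = (\<lambda>_. 0)"
  using tt_short_gt1[of g] by (auto simp: stage_def)

lemma stage_rank: "stage g i (nsl_rank g) = stage g (Suc i) 0"
  by (auto simp: stage_def)

lemma stage_final: "b \<in> nodes g \<Longrightarrow> stage g (tt_short g * k) 0 b = tt g b * k"
  using tt_short_gt1[of g] by (auto simp: stage_def ac_simps)

text \<open>In terms of slopes: s_b / t_b \<le> (i + 1) / \<open>tt_short g\<close> \<le> (s_b + 1)
  / t_b. These are the inequalities required for eliminating a variable of slope (i + 1) /
  \<open>tt_short g\<close>.\<close>

lemma stage_bounds:
  assumes "b \<in> nodes g"
  shows "stage g i a b * tt_short g \<le> (i + 1) * tt g b" "(i + 1) * tt g b \<le> (stage g i a b + 1) * tt_short g"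
proof -
  define c where "c = (if b \<le> a then i + 1 else i)"
  have st: "stage g i a b = c * tt g b div tt_short g" using assms by (simp add: stage_def c_def)
  have "c * tt g b div tt_short g * tt_short g \<le> c * tt g b" by simp
  also have "\<dots> \<le> (i + 1) * tt g b" by (intro mult_right_mono) (auto simp: c_def)
  finally show "stage g i a b * tt_short g \<le> (i + 1) * tt g b" by (simp only: st)
  have T: "tt_short g > 0" using tt_short_gt1[of g] by simp
  have "(i + 1) * tt g b \<le> (i * tt g b div tt_short g + 1) * tt_short g"
  proof (cases "tt g b = 1")
    case True
    have "i < (i div tt_short g + 1) * tt_short g"
      using dividend_less_div_times[OF T, of i] by (simp add: algebra_simps)
    then show ?thesis using True by simp
  next
    case False
    then have "tt g b = tt_short g" using tt_cases[of g b] by simp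
    then show ?thesis using T by simp
  qed
  also have "\<dots> \<le> (stage g i a b + 1) * tt_short g"
    unfolding st by (intro mult_right_mono add_mono div_le_mono) (auto simp: c_def)
  finally show "(i + 1) * tt g b \<le> (stage g i a b + 1) * tt_short g" .
qed

text \<open>A short node advances in every round, a long one only when \<open>tt_short g\<close>
  divides \<open>i + 1\<close>.\<close>

lemma stage_step:
  assumes "Suc a \<in> nodes g"
  shows "stage g i (Suc a) = stage g i a \<or>
    stage g i (Suc a) = (stage g i a)(Suc a := stage g i a (Suc a) + 1) \<and>
    (stage g i a (Suc a) + 1) * tt_short g = (i + 1) * tt g (Suc a)"
proof -
  let ?b = "Suc a" and ?T = "tt_short g"
  have T: "?T > 0" using tt_short_gt1[of g] by simp
  have other: "stage g i (Suc a) c = stage g i a c" if "c \<noteq> ?b" for c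
    using that by (auto simp: stage_def)
  have vals: "stage g i a ?b = i * tt g ?b div ?T" "stage g i ?b ?b = (i + 1) * tt g ?b div ?T"
    using assms by (auto simp: stage_def)
  consider "stage g i ?b ?b = stage g i a ?b"
    | "stage g i ?b ?b = stage g i a ?b + 1" "(stage g i a ?b + 1) * ?T = (i + 1) * tt g ?b"
  proof (cases "tt g ?b = 1")
    case True
    show thesis
    proof (cases "Suc (i mod ?T) = ?T")
      case eq: True
      have "i + 1 = i div ?T * ?T + Suc (i mod ?T)" by simp
      also have "\<dots> = (i div ?T + 1) * ?T" unfolding eq by simp
      finally have i: "i + 1 = (i div ?T + 1) * ?T" .
      then have "(i + 1) div ?T = i div ?T + 1" using T by (metis nonzero_mult_div_cancel_right not_gr0)
      then show thesis using that(2) i True unfolding vals by simp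
    next
      case False
      then show thesis using that(1) True T unfolding vals by (simp add: div_Suc mod_Suc)
    qed
  next
    case False
    then have "tt g ?b = ?T" using tt_cases[of g ?b] by simp
    then show thesis using that(2) T unfolding vals by simp
  qed
  then show ?thesis
  proof cases
    case 1
    then have "stage g i (Suc a) c = stage g i a c" for c using other by (cases "c = ?b") auto
    then have "stage g i (Suc a) = stage g i a" by (rule ext)
    then show ?thesis ..
  next
    case 2
    then have "stage g i (Suc a) = (stage g i a)(?b := stage g i a ?b + 1)" using other by auto
    with 2 show ?thesis by blast
  qed
qed

text \<open>One round removes the variables of slope (i + 1) / \<open>tt_short g\<close>, at most
  one on each node. The bounds on the other nodes come from \<open>stage_bounds\<close>, multiplied
  by \<open>tt g (Suc a)\<close> and divided by \<open>tt_short g\<close>.\<close>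

lemma partial_term_stage:
  assumes g: "nsl_valid g" and i: "i < tt_short g * k" and a: "a \<le> nsl_rank g"
    and IH: "fls_summable (families g k (stage g i 0)) (partial_term g k l n (stage g i 0))"
  shows "fls_summable (families g k (stage g i a)) (partial_term g k l n (stage g i a)) \<and>
    fls_infsum (families g k (stage g i a)) (partial_term g k l n (stage g i a)) =
    fls_infsum (families g k (stage g i 0)) (partial_term g k l n (stage g i 0))"
  using a
proof (induction a)
  case 0
  then show ?case using IH by simp
next
  case (Suc a)
  let ?s = "stage g i a"
  have b: "Suc a \<in> nodes g" using Suc.prems by simp
  have T: "tt_short g > 0" using tt_short_gt1[of g] by simp
  from stage_step[OF b, of i] show ?case
  proof
    assume "stage g i (Suc a) = ?s"
    then show ?thesis using Suc by simp
  next
    assume *: "stage g i (Suc a) = ?s(Suc a := ?s (Suc a) + 1) \<and>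
      (?s (Suc a) + 1) * tt_short g = (i + 1) * tt g (Suc a)"
    define p where "p = ?s (Suc a) + 1"
    have p: "p * tt_short g = (i + 1) * tt g (Suc a)" using * by (simp add: p_def)
    have "(i + 1) * tt g (Suc a) \<le> (tt_short g * k) * tt g (Suc a)" using i by (intro mult_right_mono) auto
    then have "p * tt_short g \<le> (tt g (Suc a) * k) * tt_short g" unfolding p by (simp add: ac_simps)
    then have pk: "p \<le> tt g (Suc a) * k" using T by simp
    have le: "?s c * tt g (Suc a) \<le> p * tt g c" "p * tt g c \<le> (?s c + 1) * tt g (Suc a)" if c: "c \<in> nodes g" for c
    proof -
      have pc: "p * tt g c * tt_short g = ((i + 1) * tt g c) * tt g (Suc a)"
        using p by (metis (no_types, lifting) mult.assoc mult.commute)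
      have "?s c * tt_short g * tt g (Suc a) \<le> ((i + 1) * tt g c) * tt g (Suc a)"
        using stage_bounds(1)[OF c] by (intro mult_right_mono) auto
      then have "?s c * tt g (Suc a) * tt_short g \<le> p * tt g c * tt_short g"
        unfolding pc by (simp add: ac_simps)
      then show "?s c * tt g (Suc a) \<le> p * tt g c" using T by simp
      have "((i + 1) * tt g c) * tt g (Suc a) \<le> (?s c + 1) * tt_short g * tt g (Suc a)"
        using stage_bounds(2)[OF c] by (intro mult_right_mono) auto
      then have "p * tt g c * tt_short g \<le> (?s c + 1) * tt g (Suc a) * tt_short g"
        unfolding pc by (simp only: ac_simps)
      then show "p * tt g c \<le> (?s c + 1) * tt g (Suc a)" using T by (simp only: mult_le_cancel2)
    qed
    note IH = Suc.IH[OF Suc_leD[OF Suc.prems]]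
    note step = g b p_def pk le conjunct1[OF IH]
    have s': "stage g i (Suc a) = ?s(Suc a := p)" using * by (simp add: p_def)
    show ?thesis unfolding s'
      using partial_term_summable_step[OF step] partial_term_infsum_step[OF step] IH by (simp only: simp_thms)
  qed
qed

lemma partial_term_final:
  assumes g: "nsl_valid g"
  shows "fls_infsum (m_families g k) (partial_term g k l n (\<lambda>_. 0)) =
    fls_infsum (families g k (stage g (tt_short g * k) 0)) (partial_term g k l n (stage g (tt_short g * k) 0))"
proof -
  have "fls_summable (families g k (stage g i 0)) (partial_term g k l n (stage g i 0)) \<and>
    fls_infsum (families g k (stage g i 0)) (partial_term g k l n (stage g i 0)) =
    fls_infsum (m_families g k) (partial_term g k l n (\<lambda>_. 0))" if "i \<le> tt_short g * k" for i
    using that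
  proof (induction i)
    case 0
    then show ?case using partial_term_summable_0[OF g] by (simp add: stage_0_0 families_0)
  next
    case (Suc i)
    then show ?case
      using partial_term_stage[OF g, of i k "nsl_rank g"] by (simp add: stage_rank)
  qed
  then show ?thesis by simp
qed

section \<open>The closed form after all variables are summed out\<close>

text \<open>By the recursion each factor is Q_i^2 / (u_i Q_(i-1) Q_(i+1)); the Q-part telescopes,
  and Q_0 = 1. The factors 1 / u_(a,i) of the theorem arise here.\<close>

lemma prod_inverse_1_minus_Yser:
  assumes g: "nsl_valid g" and a: "a \<in> nodes g"
  shows "(\<Prod>i = 1..K. 1 / (1 - Yser g a i)) =
    Qser g a 1 * Qser g a K / Qser g a (K + 1) * (\<Prod>i = 1..K. 1 / UUser g a i)"
proof (induction K)
  case 0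
  then show ?case using Qser_nonzero[OF g a] by simp
next
  case (Suc K)
  note nz = Qser_nonzero[OF g a]
  have "1 - Yser g a (Suc K) \<in> unit_series g"
    using Yser_expandable[OF g a, of "Suc K"] by (intro unit_series_1_minus) auto
  then have Y: "1 - Yser g a (Suc K) \<noteq> 0" by (simp add: unit_series_def)
  have rec: "Qser g a (Suc K + 1) =
      Qser g a (Suc K) ^ 2 * (1 - Yser g a (Suc K)) / (UUser g a (Suc K) * Qser g a K)"
    using Qser_Suc_Suc[OF g nz] by simp
  then have "1 / (1 - Yser g a (Suc K)) =
      Qser g a (Suc K) ^ 2 / (UUser g a (Suc K) * Qser g a K * Qser g a (Suc K + 1))"
    using nz Y by (simp del: Qser_0)
  then show ?case
    using Suc nz by (simp add: power2_eq_square ac_simps)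
qed

text \<open>Of the exponent \<open>l + 1\<close>, the part \<open>l\<close> is the final boundary
  factor and 1 comes from the telescoped product.\<close>

lemma Phi_factor:
  assumes g: "nsl_valid g" and a: "a \<in> nodes g"
  shows "Phi g (Qfun g a 1 * Qfun g a K ^ (l + 1) / Qfun g a (K + 1) ^ (l + 1)
      * (\<Prod>i = 1..K. Qfun g a i ^ n i / rvar (UUv a i)))
    = (\<Prod>i = 1..K. Qser g a i ^ n i / (1 - Yser g a i)) * (Qser g a K ^ l / Qser g a (K + 1) ^ l)"
proof -
  have "(\<Prod>i = 1..K. Qser g a i ^ n i / (1 - Yser g a i)) =
      (\<Prod>i = 1..K. Qser g a i ^ n i) * (\<Prod>i = 1..K. 1 / (1 - Yser g a i))"
    by (simp add: prod.distrib[symmetric])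
  also have "\<dots> = (\<Prod>i = 1..K. Qser g a i ^ n i / UUser g a i) * (Qser g a 1 * Qser g a K / Qser g a (K + 1))"
    unfolding prod_inverse_1_minus_Yser[OF assms] by (simp add: prod_dividef)
  finally have eq: "(\<Prod>i = 1..K. Qser g a i ^ n i / (1 - Yser g a i)) = \<dots>" .
  show ?thesis
    unfolding eq Phi_mult Phi_divide Phi_power Phi_prod Phi_rvar Qser_def[symmetric]
    by (simp add: ac_simps)
qed

lemma partial_term_final_eq:
  assumes g: "nsl_valid g"
  shows "fls_infsum (families g k (stage g (tt_short g * k) 0)) (partial_term g k l n (stage g (tt_short g * k) 0))
    = (\<Prod>a\<in>nodes g. Phi g (Qfun g a 1 * Qfun g a (tt g a * k) ^ (l a + 1) / Qfun g a (tt g a * k + 1) ^ (l a + 1)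
              * (\<Prod>i = 1..tt g a * k. Qfun g a i ^ n a i / rvar (UUv a i))))"
proof -
  define s where "s = stage g (tt_short g * k) 0"
  have s: "s a = tt g a * k" if "a \<in> nodes g" for a using stage_final[OF that] by (simp add: s_def)
  have rem: "remaining g k s = {}" by (auto simp: remaining_def Jset_def s)
  then have fam: "families g k s = {\<lambda>_ _. 0}" by (auto simp: families_def fun_eq_iff)
  have bdry: "boundary_factor g k l n s m a = Qser g a (tt g a * k) ^ l a / Qser g a (tt g a * k + 1) ^ l a"
    if "a \<in> nodes g" for a m
    using that by (simp add: boundary_factor_def q_lin_def rem s power_int_minus divide_inverse)
  have "(\<Prod>q\<in>Jset g k. done_factor g n q) = (\<Prod>a\<in>nodes g. \<Prod>i = 1..tt g a * k. Qser g a i ^ n a i / (1 - Yser g a i))"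
    by (simp add: Jset_def prod.Sigma done_factor_def)
  then have "partial_term g k l n s (\<lambda>_ _. 0) =
      (\<Prod>a\<in>nodes g. (\<Prod>i = 1..tt g a * k. Qser g a i ^ n a i / (1 - Yser g a i))
        * (Qser g a (tt g a * k) ^ l a / Qser g a (tt g a * k + 1) ^ l a))"
    unfolding partial_term_def rem prod.distrib by (simp add: bdry)
  also have "\<dots> = (\<Prod>a\<in>nodes g. Phi g (Qfun g a 1 * Qfun g a (tt g a * k) ^ (l a + 1)
      / Qfun g a (tt g a * k + 1) ^ (l a + 1) * (\<Prod>i = 1..tt g a * k. Qfun g a i ^ n a i / rvar (UUv a i))))"
    by (intro prod.cong refl Phi_factor[symmetric] g)
  finally show ?thesis unfolding s_def[symmetric] fam fls_infsum_singleton .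
qed

lemma series_prod_ser:
  assumes "\<And>a. a \<in> {1..r} \<Longrightarrow> \<exists>d. F a \<in> cone_series g d"
  shows "series_prod (\<lambda>a. ser g (F a)) r = ser g (\<Prod>a = 1..r. F a) \<and> (\<exists>d. (\<Prod>a = 1..r. F a) \<in> cone_series g d)"
  using assms
proof (induction r)
  case 0
  show ?case using one_cone_series by (auto simp: ser_1 intro!: exI[of _ 0])
next
  case (Suc r)
  then obtain d where d: "(\<Prod>a = 1..r. F a) \<in> cone_series g d" by fastforce
  obtain d' where d': "F (Suc r) \<in> cone_series g d'" using Suc.prems[of "Suc r"] by auto
  have "series_prod (\<lambda>a. ser g (F a)) r = ser g (\<Prod>a = 1..r. F a)" using Suc by simp
  then show ?case using ser_mult[OF d d'] cone_series_mult[OF d d'] by auto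
qed

text \<open>The existential leaves no freedom: by \<open>y_expansion_unique\<close> each
  \<open>E a\<close> with \<open>a\<close> a node is the expansion of its factor.\<close>

theorem theorem5p5:
  fixes g :: nsl_type and k :: nat and l :: "nat \<Rightarrow> nat" and n :: "nat \<Rightarrow> nat \<Rightarrow> nat"
  assumes "nsl_valid g" and "k \<ge> 1"
  shows "\<exists>E. (\<forall>a\<in>nodes g. y_expansion g
             (Qfun g a 1 * Qfun g a (tt g a * k) ^ (l a + 1) / Qfun g a (tt g a * k + 1) ^ (l a + 1)
              * (\<Prod>i = 1..tt g a * k. Qfun g a i ^ n a i / rvar (UUv a i)))
             (E a)) \<and>
           Z_series g k l n = series_prod E (nsl_rank g)"
proof -
  define F where "F a = Qfun g a 1 * Qfun g a (tt g a * k) ^ (l a + 1) / Qfun g a (tt g a * k + 1) ^ (l a + 1)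
              * (\<Prod>i = 1..tt g a * k. Qfun g a i ^ n a i / rvar (UUv a i))" for a
  have cone: "\<exists>d. Phi g (F a) \<in> cone_series g d" if a: "a \<in> nodes g" for a
  proof -
    \<comment> \<open>Membership in some cone is all that is needed, so the leading exponents are
      forgotten and only closure under products, quotients and powers is used.\<close>
    define L where "L = (\<Union>v. lead_series g v)"
    have Q: "Qser g a i \<in> L" for i using Qser_lead_series[OF assms(1) a] by (auto simp: L_def)
    have UU: "UUser g a i \<in> L" for i using monom_fls_UU_lead_series by (auto simp: L_def)
    have mult: "x * y \<in> L" if "x \<in> L" "y \<in> L" for x y
      using that lead_series_mult[OF _ _ refl] unfolding L_def by blast
    have divide: "x / y \<in> L" if "x \<in> L" "y \<in> L" for x y
      using that lead_series_divide[OF _ _ refl] unfolding L_def by blast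
    have power: "x ^ i \<in> L" if "x \<in> L" for x i
      using that lead_series_power[OF _ refl] unfolding L_def by blast
    have one: "1 \<in> L" using lead_series_unit[OF one_unit_series] by (auto simp: L_def)
    have prod: "prod f A \<in> L" if "\<And>i. f i \<in> L" for f and A :: "nat set"
      by (induction A rule: infinite_finite_induct) (auto intro: mult one that)
    have "Phi g (F a) = Qser g a 1 * Qser g a (tt g a * k) ^ (l a + 1) / Qser g a (tt g a * k + 1) ^ (l a + 1)
        * (\<Prod>i = 1..tt g a * k. Qser g a i ^ n a i / UUser g a i)"
      by (simp add: F_def Phi_mult Phi_divide Phi_power Phi_prod Phi_rvar Qser_def)
    also have "\<dots> \<in> L"
      using Q UU by (intro mult divide power prod)
    finally show ?thesis using lead_series_cone_series by (auto simp: L_def)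
  qed
  have "Z_series g k l n = ser g (\<Prod>a\<in>nodes g. Phi g (F a))"
    using ser_infsum_partial_term_0[OF assms(1)] partial_term_final[OF assms(1)]
      partial_term_final_eq[OF assms(1)] by (simp only: F_def)
  also have "\<dots> = series_prod (\<lambda>a. ser g (Phi g (F a))) (nsl_rank g)"
    using series_prod_ser[of "nsl_rank g" "\<lambda>a. Phi g (F a)"] cone by simp
  finally show ?thesis
    using cone y_expansion_ser_Phi unfolding F_def[symmetric]
    by (intro exI[of _ "\<lambda>a. ser g (Phi g (F a))"]) blast
qed

end
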